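(* If the Bessis-Moussa-Villani conjecture is true for infinitely many positive integers $m$, then it is true for all positive integers $m$.
   Context: Matrices are complex. A positive semidefinite matrix is a complex Hermitian matrix all of whose eigenvalues are nonnegative. For a positive integer $m$, "the Bessis-Moussa-Villani conjecture is true for $m$" means: for every positive integer $n$ and all $n\times n$ positive semidefinite matrices $A$ and $B$, the polynomial $p(t) = \mathrm{Tr}[(A+tB)^m]$ in $t$ (which has real coefficients) has all nonnegative coefficients. *)

theory Defs
  imports
    "HOL-Library.Nonpos_Ints"
    "Jordan_Normal_Form.Char_Poly"
    "Jordan_Normal_Form.Schur_Decomposition"
begin

definition hermitian_mat :: "complex mat \<Rightarrow> bool" where
  "hermitian_mat A \<longleftrightarrow> square_mat A \<and> mat_adjoint A = A"

text \<open>Here \<open>\<real>\<^sub>\<ge>\<^sub>0\<close> is the set of nonnegative reals embedded in the complex numbers,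
  so membership includes the assertion that the number is real.\<close>

definition psd_mat :: "complex mat \<Rightarrow> bool" where
  "psd_mat A \<longleftrightarrow> hermitian_mat A \<and> (\<forall>k. eigenvalue A k \<longrightarrow> k \<in> \<real>\<^sub>\<ge>\<^sub>0)"

definition mat_trace :: "'a :: comm_monoid_add mat \<Rightarrow> 'a" where
  "mat_trace A = (\<Sum>i<dim_row A. A $$ (i, i))"

text \<open>The polynomial \<open>Tr[(A + t B)\<^sup>m]\<close> in the indeterminate \<open>t\<close>: the power and the trace are
  taken over the ring of polynomials, \<open>A\<close> and \<open>B\<close> being viewed as matrices of constant
  polynomials and \<open>[:0, 1:]\<close> being the indeterminate.\<close>

definition bmv_poly :: "nat \<Rightarrow> complex mat \<Rightarrow> complex mat \<Rightarrow> complex poly" where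
  "bmv_poly m A B =
     mat_trace ((map_mat (\<lambda>a. [:a:]) A + [:0, 1:] \<cdot>\<^sub>m map_mat (\<lambda>b. [:b:]) B) ^\<^sub>m m)"

lemma poly_bmv_poly:
  assumes A: "A \<in> carrier_mat n n" and B: "B \<in> carrier_mat n n"
  shows "poly (bmv_poly m A B) t = mat_trace ((A + t \<cdot>\<^sub>m B) ^\<^sub>m m)"
proof -
  have ev: "semiring_hom (\<lambda>p :: complex poly. poly p t)"
    by unfold_locales auto
  define M where "M = map_mat (\<lambda>a. [:a:]) A + [:0, 1:] \<cdot>\<^sub>m map_mat (\<lambda>b. [:b:]) B"
  have M: "M \<in> carrier_mat n n"
    using A B by (auto simp: M_def)
  have eq: "map_mat (\<lambda>p. poly p t) M = A + t \<cdot>\<^sub>m B"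
    using A B by (intro eq_matI) (auto simp: M_def)
  have dim: "dim_row (M ^\<^sub>m m) = n" "dim_col (M ^\<^sub>m m) = n"
    using pow_carrier_mat[OF M, of m] by auto
  have "poly (mat_trace (M ^\<^sub>m m)) t = mat_trace (map_mat (\<lambda>p. poly p t) (M ^\<^sub>m m))"
    by (simp add: mat_trace_def poly_sum dim del: pow_mat_dim)
  also have "\<dots> = mat_trace ((A + t \<cdot>\<^sub>m B) ^\<^sub>m m)"
    by (simp only: semiring_hom.mat_hom_pow[OF ev M] eq)
  finally show ?thesis
    by (simp add: bmv_poly_def M_def)
qed

definition bmv_conjecture :: "nat \<Rightarrow> bool" where
  "bmv_conjecture m \<longleftrightarrow>
     (\<forall>n > 0. \<forall>A \<in> carrier_mat n n. \<forall>B \<in> carrier_mat n n. psd_mat A \<longrightarrow> psd_mat B \<longrightarrow>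
        (\<forall>k. coeff (bmv_poly m A B) k \<in> \<real>\<^sub>\<ge>\<^sub>0))"

end

theory Submission
  imports "HOL-Analysis.Function_Topology" "HOL-Analysis.Topology_Euclidean_Space" Defs
begin

text \<open>
  It suffices to descend by one: if the conjecture holds for \<open>m + 1\<close>, then it holds for \<open>m \<ge> 1\<close>
  (lemma \<open>bmv_conjecture_descent\<close>). Write \<open>T(A, B)\<close> for the coefficient of \<open>t\<^sup>k\<close> in
  \<open>Tr[(A + t B)\<^sup>m]\<close>, and suppose that it is negative for some positive semidefinite \<open>A\<close> and \<open>B\<close>.

  As \<open>T\<close> is continuous, adding a small multiple of the identity to both matrices keeps it negative and
  makes the traces positive; as \<open>T\<close> is homogeneous of degree \<open>m - k\<close> in \<open>A\<close> and \<open>k\<close> in \<open>B\<close>, both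
  traces can then be scaled to \<open>1\<close>. The pairs of positive semidefinite matrices of trace \<open>1\<close> form a
  compact set (the image of a product of two unit spheres under \<open>(X, Z) \<mapsto> (X X*, Z Z*)\<close>), so \<open>T\<close>
  attains its minimum \<open>\<mu> < 0\<close> on it, say at \<open>(A, B)\<close>. By homogeneity
  \<open>T(A', B') \<ge> \<mu> (Tr A')\<^bsup>m-k\<^esup> (Tr B')\<^sup>k\<close> whenever the traces are positive, with equality at \<open>(A, B)\<close>.

  Now move both matrices by the same congruence: put \<open>G = A + B\<close>, \<open>A\<^sub>s = (1 + s G) A (1 + s G)\<close> and
  \<open>B\<^sub>s = (1 + s G) B (1 + s G)\<close>. The difference of the two sides of the inequality at \<open>(A\<^sub>s, B\<^sub>s)\<close> is
  minimal at \<open>s = 0\<close>, so its derivative there is \<open>0\<close>. On the left, \<open>A\<^sub>s + t B\<^sub>s\<close> is a congruence of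
  \<open>A + t B\<close>, and cyclicity of the trace makes the derivative \<open>2 m\<close> times the coefficient of \<open>t\<^sup>k\<close> in
  \<open>Tr[(A + t B)\<^sup>m (A + B)]\<close> (lemma \<open>bmv_poly_congruence_expansion\<close>). This is a combination with
  nonnegative weights of the coefficients of \<open>t\<^sup>k\<close> and \<open>t\<^bsup>k+1\<^esup>\<close> in \<open>Tr[(A + t B)\<^bsup>m+1\<^esup>]\<close>
  (lemma \<open>coeff_trace_pencil_pow_mult_sum\<close>), hence nonnegative. On the right, the derivative is
  \<open>2 \<mu> ((m - k) Tr(A G) + k Tr(B G))\<close>, which is negative because \<open>Tr(A\<^sup>2)\<close> and \<open>Tr(B\<^sup>2)\<close> are positive
  and \<open>Tr(A B)\<close> is nonnegative. These signs are incompatible.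
\<close>

section \<open>Traces and derivatives of matrix powers\<close>

lemma square_mult_carrier [simp]:
  "A \<in> carrier_mat n n \<Longrightarrow> B \<in> carrier_mat n n \<Longrightarrow> A * B \<in> carrier_mat n n"
  by (rule mult_carrier_mat)

lemma mat_trace_mult:
  fixes A B :: "'a :: comm_semiring_1 mat"
  assumes "A \<in> carrier_mat n m" "B \<in> carrier_mat m n"
  shows "mat_trace (A * B) = (\<Sum>i<n. \<Sum>j<m. A $$ (i, j) * B $$ (j, i))"
proof -
  have "(A * B) $$ (i, i) = (\<Sum>j<m. A $$ (i, j) * B $$ (j, i))" if "i < n" for i
    using assms that by (auto simp: scalar_prod_def atLeast0LessThan)
  thus ?thesis
    using assms by (simp add: mat_trace_def)
qed

lemma mat_trace_mult_comm:
  fixes A B :: "'a :: comm_semiring_1 mat"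
  assumes "A \<in> carrier_mat n m" "B \<in> carrier_mat m n"
  shows "mat_trace (A * B) = mat_trace (B * A)"
  unfolding mat_trace_mult[OF assms] mat_trace_mult[OF assms(2,1)]
  by (subst sum.swap) (simp add: mult.commute)

lemma mat_trace_add:
  assumes "A \<in> carrier_mat n n" "B \<in> carrier_mat n n"
  shows "mat_trace (A + B) = mat_trace A + mat_trace B"
  using assms by (simp add: mat_trace_def sum.distrib)

lemma mat_trace_smult:
  fixes A :: "'a :: comm_semiring_1 mat"
  assumes "A \<in> carrier_mat n n"
  shows "mat_trace (c \<cdot>\<^sub>m A) = c * mat_trace A"
  using assms by (simp add: mat_trace_def sum_distrib_left)

lemma pow_mat_add:
  assumes "A \<in> carrier_mat n n"
  shows "A ^\<^sub>m (j + k) = A ^\<^sub>m j * A ^\<^sub>m k"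
proof (induction k)
  case 0
  thus ?case using assms by simp
next
  case (Suc k)
  thus ?case using assms
    by (simp add: assoc_mult_mat[of _ n n _ n _ n])
qed

lemma pow_mat_Suc_left:
  assumes "A \<in> carrier_mat n n"
  shows "A ^\<^sub>m Suc k = A * A ^\<^sub>m k"
  using pow_mat_add[OF assms, of 1 k] assms by simp

lemma pderiv_mat_trace:
  fixes A :: "'a :: idom poly mat"
  assumes "A \<in> carrier_mat n n"
  shows "pderiv (mat_trace A) = mat_trace (map_mat pderiv A)"
  using assms higher_pderiv_sum[of 1] by (simp add: mat_trace_def)

lemma map_mat_pderiv_mult:
  fixes A B :: "'a :: idom poly mat"
  assumes "A \<in> carrier_mat n m" "B \<in> carrier_mat m l"
  shows "map_mat pderiv (A * B) = map_mat pderiv A * B + A * map_mat pderiv B"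
proof (rule eq_matI)
  fix i j
  assume "i < dim_row (map_mat pderiv A * B + A * map_mat pderiv B)"
     and "j < dim_col (map_mat pderiv A * B + A * map_mat pderiv B)"
  hence "i < n" "j < l" using assms by auto
  thus "map_mat pderiv (A * B) $$ (i, j) = (map_mat pderiv A * B + A * map_mat pderiv B) $$ (i, j)"
    using assms higher_pderiv_sum[of 1 "\<lambda>k. A $$ (i, k) * B $$ (k, j)" "{0..<m}"]
    by (simp add: scalar_prod_def pderiv_mult sum.distrib mult.commute add.commute)
qed (use assms in auto)

text \<open>The factor \<open>M\<^sup>j\<close> makes the induction on the exponent work: in
  \<open>(M\<^bsup>N+1\<^esup>)' = (M\<^sup>N)' M + M\<^sup>N M'\<close>, cyclicity moves the trailing \<open>M\<close> of the first summand to the front.\<close>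
lemma mat_trace_pow_mult_pderiv:
  fixes M :: "'a :: idom poly mat"
  assumes M: "M \<in> carrier_mat n n"
  shows "mat_trace (M ^\<^sub>m j * map_mat pderiv (M ^\<^sub>m Suc N)) =
         of_nat (Suc N) * mat_trace (M ^\<^sub>m (j + N) * map_mat pderiv M)"
proof (induction N arbitrary: j)
  case 0
  thus ?case using M by simp
next
  case (Suc N)
  define D where "D = map_mat pderiv M"
  define P where "P = M ^\<^sub>m Suc N"
  define E where "E = map_mat pderiv P"
  have [simp]: "D \<in> carrier_mat n n" "P \<in> carrier_mat n n" "E \<in> carrier_mat n n"
      "M \<in> carrier_mat n n"
    using M by (simp_all add: D_def P_def E_def del: pow_mat.simps)
  have Pj: "M ^\<^sub>m k \<in> carrier_mat n n" for k
    using M by simp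
  have "map_mat pderiv (M ^\<^sub>m Suc (Suc N)) = E * M + P * D"
    unfolding pow_mat.simps(2)[of M "Suc N"]
    by (subst map_mat_pderiv_mult[of _ n n _ n]) (simp_all add: E_def P_def D_def M del: pow_mat.simps)
  hence "M ^\<^sub>m j * map_mat pderiv (M ^\<^sub>m Suc (Suc N)) = (M ^\<^sub>m j * E) * M + (M ^\<^sub>m j * P) * D"
    using Pj[of j]
    by (simp add: mult_add_distrib_mat[of _ n n _ n] assoc_mult_mat[of _ n n _ n _ n] del: pow_mat.simps)
  hence "mat_trace (M ^\<^sub>m j * map_mat pderiv (M ^\<^sub>m Suc (Suc N))) =
        mat_trace ((M ^\<^sub>m j * E) * M) + mat_trace ((M ^\<^sub>m j * P) * D)"
    using Pj[of j] by (simp add: mat_trace_add[of _ n] del: pow_mat.simps)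
  also have "mat_trace ((M ^\<^sub>m j * E) * M) = mat_trace (M * (M ^\<^sub>m j * E))"
    using Pj[of j] by (intro mat_trace_mult_comm[of _ n n]) auto
  also have "M * (M ^\<^sub>m j * E) = M ^\<^sub>m Suc j * E"
    using Pj[of j] unfolding pow_mat_Suc_left[OF M]
    by (subst assoc_mult_mat[of _ n n _ n _ n]) auto
  also have "mat_trace (M ^\<^sub>m Suc j * E) = of_nat (Suc N) * mat_trace (M ^\<^sub>m (Suc j + N) * D)"
    unfolding E_def P_def D_def by (rule Suc.IH)
  also have "M ^\<^sub>m j * P = M ^\<^sub>m (j + Suc N)"
    unfolding P_def by (rule pow_mat_add[OF M, symmetric])
  finally show ?case
    by (simp add: D_def algebra_simps del: pow_mat.simps)
qed

lemma pderiv_mat_trace_pow: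
  fixes M :: "'a :: idom poly mat"
  assumes M: "M \<in> carrier_mat n n"
  shows "pderiv (mat_trace (M ^\<^sub>m Suc N)) =
         of_nat (Suc N) * mat_trace (M ^\<^sub>m N * map_mat pderiv M)"
proof -
  have 1: "M ^\<^sub>m Suc N \<in> carrier_mat n n"
    using M by (rule pow_carrier_mat)
  show ?thesis
    using mat_trace_pow_mult_pderiv[OF M, of 0 N] M 1
    unfolding pderiv_mat_trace[OF 1] by (simp del: pow_mat.simps(2))
qed

section \<open>The pencil \<open>A + t B\<close>\<close>

abbreviation const_mat :: "'a :: zero mat \<Rightarrow> 'a poly mat" where
  "const_mat \<equiv> map_mat (\<lambda>a. [:a:])"

definition pencil :: "'a :: comm_ring_1 mat \<Rightarrow> 'a mat \<Rightarrow> 'a poly mat" where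
  "pencil A B = const_mat A + [:0, 1:] \<cdot>\<^sub>m const_mat B"

lemma bmv_poly_eq: "bmv_poly N A B = mat_trace (pencil A B ^\<^sub>m N)"
  by (simp add: bmv_poly_def pencil_def)

lemma pencil_carrier [simp]:
  "B \<in> carrier_mat n n \<Longrightarrow> pencil A B \<in> carrier_mat n n"
  by (simp add: pencil_def)

lemma pencil_dim [simp]:
  "dim_row (pencil A B) = dim_row B" "dim_col (pencil A B) = dim_col B"
  by (simp_all add: pencil_def)

lemma pencil_index:
  assumes "A \<in> carrier_mat n n" "B \<in> carrier_mat n n" "i < n" "j < n"
  shows "pencil A B $$ (i, j) = [:A $$ (i, j), B $$ (i, j):]"
  using assms by (simp add: pencil_def)

lemma semiring_hom_const: "semiring_hom (\<lambda>a :: 'a :: comm_ring_1. [:a:])"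
  by unfold_locales (auto simp: one_pCons)

lemma semiring_hom_poly: "semiring_hom (\<lambda>p :: 'a :: comm_ring_1 poly. poly p x)"
  by unfold_locales auto

lemmas const_mat_mult = semiring_hom.mat_hom_mult[OF semiring_hom_const]
lemmas poly_mat_mult = semiring_hom.mat_hom_mult[OF semiring_hom_poly]

lemma poly_const_mat [simp]: "map_mat (\<lambda>p. poly p x) (const_mat A) = A"
  by (intro eq_matI) auto

lemma poly_pencil:
  assumes "A \<in> carrier_mat n n" "B \<in> carrier_mat n n"
  shows "map_mat (\<lambda>p. poly p x) (pencil A B) = A + x \<cdot>\<^sub>m B"
  using assms by (intro eq_matI) (auto simp: pencil_def)

lemma mat_trace_hom:
  assumes "semiring_hom h" "M \<in> carrier_mat n n"
  shows "mat_trace (map_mat h M) = h (mat_trace M)"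
proof -
  interpret semiring_hom h by fact
  show ?thesis using assms(2) by (simp add: mat_trace_def hom_sum)
qed

lemma pderiv_const_mat [simp]:
  "map_mat pderiv (const_mat A) = 0\<^sub>m (dim_row A) (dim_col A)"
  by (intro eq_matI) auto

lemma pderiv_pencil:
  fixes A B :: "'a :: idom mat"
  assumes "A \<in> carrier_mat n n" "B \<in> carrier_mat n n"
  shows "map_mat pderiv (pencil A B) = const_mat B"
  using assms by (intro eq_matI) (auto simp: pencil_def pderiv_pCons)

lemma pencil_mult:
  assumes "A \<in> carrier_mat n n" "B \<in> carrier_mat n n" "Y \<in> carrier_mat n n" "Z \<in> carrier_mat n n"
  shows "pencil (Y * A * Z) (Y * B * Z) = const_mat Y * pencil A B * const_mat Z"
proof -
  have "const_mat (Y * A * Z) = const_mat Y * const_mat A * const_mat Z"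
    if "A \<in> carrier_mat n n" for A
    using that assms by (simp add: const_mat_mult[of _ n n _ n])
  thus ?thesis
    using assms unfolding pencil_def
    by (simp add: mult_smult_distrib[of _ n n _ n] mult_smult_assoc_mat[of _ n n _ n] mult_add_distrib_mat[of _ n n _ n] add_mult_distrib_mat[of _ n n _ _ n])
qed

text \<open>With \<open>P = Tr[(A + t B)\<^bsup>N+1\<^esup>]\<close> one has \<open>P' = (N + 1) Tr[(A + t B)\<^sup>N B]\<close>, and
  \<open>A + B = (A + t B) + (1 - t) B\<close>. For \<open>k \<le> N + 1\<close> both weights on the right are nonnegative.\<close>
lemma coeff_trace_pencil_pow_mult_sum:
  fixes A B :: "complex mat" and N k :: nat
  assumes A: "A \<in> carrier_mat n n" and B: "B \<in> carrier_mat n n"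
  defines "P \<equiv> bmv_poly (Suc N) A B"
  shows "of_nat (Suc N) * coeff (mat_trace (pencil A B ^\<^sub>m N * const_mat (A + B))) k =
         (of_nat (Suc N) - of_nat k) * coeff P k + of_nat (Suc k) * coeff P (Suc k)"
proof -
  define C where "C = pencil A B"
  define q where "q = mat_trace (C ^\<^sub>m N * const_mat B)"
  have C [simp]: "C \<in> carrier_mat n n" "C ^\<^sub>m N \<in> carrier_mat n n"
    using B by (auto simp: C_def)
  have dP: "pderiv P = of_nat (Suc N) * q"
    unfolding P_def bmv_poly_eq q_def C_def
    by (subst pderiv_mat_trace_pow[of _ n]) (simp_all add: A B pderiv_pencil[of _ n])
  have "const_mat (A + B) = C + [:1, -1:] \<cdot>\<^sub>m const_mat B"
    using A B by (intro eq_matI) (auto simp: C_def pencil_def)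
  hence "mat_trace (C ^\<^sub>m N * const_mat (A + B)) =
        mat_trace (C ^\<^sub>m N * C) + mat_trace (C ^\<^sub>m N * ([:1, -1:] \<cdot>\<^sub>m const_mat B))"
    using B by (simp add: mult_add_distrib_mat[of _ n n _ n] mat_trace_add[of _ n])
  also have "mat_trace (C ^\<^sub>m N * ([:1, -1:] \<cdot>\<^sub>m const_mat B)) = [:1, -1:] * q"
    using B unfolding q_def
    by (subst mult_smult_distrib[of _ n n _ n]) (simp_all add: mat_trace_smult[of _ n])
  also have "mat_trace (C ^\<^sub>m N * C) = P"
    by (simp add: P_def bmv_poly_eq C_def)
  finally have "of_nat (Suc N) * mat_trace (C ^\<^sub>m N * const_mat (A + B)) =
      of_nat (Suc N) * P + [:1, -1:] * pderiv P"
    unfolding dP by (simp add: algebra_simps)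
  moreover have "[:1, -1:] * pderiv P = pderiv P - pCons 0 (pderiv P)"
    by (intro poly_eqI) (simp add: coeff_pCons split: nat.split)
  ultimately have "coeff (of_nat (Suc N) * mat_trace (C ^\<^sub>m N * const_mat (A + B))) k =
      coeff (of_nat (Suc N) * P + (pderiv P - pCons 0 (pderiv P))) k"
    by (simp only:)
  thus ?thesis
    unfolding C_def [symmetric] of_nat_poly
    by (cases k) (simp_all add: coeff_pderiv coeff_pCons algebra_simps)
qed

text \<open>The polynomial \<open>Q\<close> has its coefficients in the ring of polynomials in \<open>t\<close>, and its own
  indeterminate stands for the parameter \<open>s\<close> of the congruence. The derivative in \<open>s\<close> at \<open>0\<close> of
  \<open>C\<^sub>s = (1 + s G) C (1 + s G)\<close> is \<open>G C + C G\<close>, and both summands contribute the same trace.\<close>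
lemma bmv_poly_congruence_expansion:
  fixes A B G :: "complex mat"
  assumes A: "A \<in> carrier_mat n n" and B: "B \<in> carrier_mat n n" and G: "G \<in> carrier_mat n n"
  obtains Q where
    "\<And>s. bmv_poly (Suc N) ((1\<^sub>m n + s \<cdot>\<^sub>m G) * A * (1\<^sub>m n + s \<cdot>\<^sub>m G))
                       ((1\<^sub>m n + s \<cdot>\<^sub>m G) * B * (1\<^sub>m n + s \<cdot>\<^sub>m G)) = poly Q [:s:]"
    "coeff Q 1 = of_nat (2 * Suc N) * mat_trace (pencil A B ^\<^sub>m Suc N * const_mat G)"
proof -
  define C where "C = pencil A B"
  \<comment> \<open>A pencil again, now in the outer variable and over the polynomials in \<open>t\<close>.\<close>
  define Y where "Y = pencil (1\<^sub>m n) (const_mat G)"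
  define M where "M = Y * const_mat C * Y"
  define Q where "Q = mat_trace (M ^\<^sub>m Suc N)"
  have [simp]: "C \<in> carrier_mat n n" "Y \<in> carrier_mat n n" "M \<in> carrier_mat n n"
      "C ^\<^sub>m N \<in> carrier_mat n n" "M ^\<^sub>m N \<in> carrier_mat n n"
    using B G by (auto simp: C_def Y_def M_def)
  note [simp] = A B G
  have evM: "map_mat (\<lambda>p. poly p x) M = (1\<^sub>m n + x \<cdot>\<^sub>m const_mat G) * C * (1\<^sub>m n + x \<cdot>\<^sub>m const_mat G)"
    for x unfolding M_def
    by (simp add: poly_mat_mult[of _ n n _ n] Y_def poly_pencil[of _ n])
  have evQ: "poly Q x = mat_trace (map_mat (\<lambda>p. poly p x) M ^\<^sub>m Suc N)" for x
    unfolding Q_def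
    by (subst semiring_hom.mat_hom_pow[OF semiring_hom_poly, symmetric, of _ n], simp)
       (subst mat_trace_hom[OF semiring_hom_poly, of _ n], auto)
  show ?thesis
  proof (rule that)
    fix s :: complex
    have "1\<^sub>m n + [:s:] \<cdot>\<^sub>m const_mat G = const_mat (1\<^sub>m n + s \<cdot>\<^sub>m G)"
      by (intro eq_matI) (auto simp: carrier_matD[OF G] one_pCons)
    thus "bmv_poly (Suc N) ((1\<^sub>m n + s \<cdot>\<^sub>m G) * A * (1\<^sub>m n + s \<cdot>\<^sub>m G))
         ((1\<^sub>m n + s \<cdot>\<^sub>m G) * B * (1\<^sub>m n + s \<cdot>\<^sub>m G)) = poly Q [:s:]"
      unfolding evQ evM bmv_poly_eq by (simp add: pencil_mult[of _ n] C_def del: pow_mat.simps)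
  next
    have ev0: "map_mat (\<lambda>p. poly p 0) M = C"
    proof -
      have "1\<^sub>m n + 0 \<cdot>\<^sub>m const_mat G = 1\<^sub>m n"
        by (intro eq_matI) (auto simp: carrier_matD[OF G])
      thus ?thesis
        unfolding evM by (simp add: left_mult_one_mat[of _ n n] right_mult_one_mat[of _ n n])
    qed
    have dM: "map_mat pderiv M = const_mat (const_mat G) * const_mat C * Y + Y * const_mat C * const_mat (const_mat G)"
      unfolding M_def
      by (simp add: map_mat_pderiv_mult[of _ n n _ n] Y_def pderiv_pencil[of _ n]
            carrier_matD[OF \<open>C \<in> carrier_mat n n\<close>] right_mult_zero_mat[of _ n n n] right_add_zero_mat[of _ n n])
    have Y0: "map_mat (\<lambda>p. poly p 0) Y = 1\<^sub>m n"
      unfolding Y_def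
      by (subst poly_pencil[of _ n], simp, simp) (intro eq_matI, auto simp: carrier_matD[OF G])
    have "poly (pderiv Q) 0 = of_nat (Suc N) * mat_trace (C ^\<^sub>m N * map_mat (\<lambda>p. poly p 0) (map_mat pderiv M))"
      unfolding Q_def
      by (subst pderiv_mat_trace_pow[of _ n], simp)
         (simp add: mat_trace_hom[OF semiring_hom_poly, symmetric, of _ n] poly_mat_mult[of _ n n _ n]
           semiring_hom.mat_hom_pow[OF semiring_hom_poly, of _ n] ev0 del: of_nat_Suc)
    also have "map_mat (\<lambda>p. poly p 0) (map_mat pderiv M) = const_mat G * C + C * const_mat G"
    proof -
      have "map_mat (\<lambda>p. poly p 0) (U + V) = map_mat (\<lambda>p. poly p 0) U + map_mat (\<lambda>p. poly p 0) V"
        if "U \<in> carrier_mat n n" "V \<in> carrier_mat n n" for U V :: "complex poly poly mat"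
        using that by (intro eq_matI) auto
      thus ?thesis
        unfolding dM by (simp add: poly_mat_mult[of _ n n _ n] Y0 left_mult_one_mat[of _ n n] right_mult_one_mat[of _ n n])
    qed
    also have "mat_trace (C ^\<^sub>m N * (const_mat G * C + C * const_mat G)) =
        mat_trace (C ^\<^sub>m N * const_mat G * C) + mat_trace (C ^\<^sub>m Suc N * const_mat G)"
      by (simp add: mult_add_distrib_mat[of _ n n _ n] mat_trace_add[of _ n] assoc_mult_mat[of _ n n _ n _ n])
    also have "mat_trace (C ^\<^sub>m N * const_mat G * C) = mat_trace (C * (C ^\<^sub>m N * const_mat G))"
      by (rule mat_trace_mult_comm[of _ n n]) auto
    also have "C * (C ^\<^sub>m N * const_mat G) = C ^\<^sub>m Suc N * const_mat G"
      unfolding pow_mat_Suc_left[OF \<open>C \<in> carrier_mat n n\<close>]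
      by (subst assoc_mult_mat[of _ n n _ n _ n]) auto
    finally have "poly (pderiv Q) 0 = of_nat (2 * Suc N) * mat_trace (C ^\<^sub>m Suc N * const_mat G)"
      by (simp add: algebra_simps)
    thus "coeff Q 1 = of_nat (2 * Suc N) * mat_trace (pencil A B ^\<^sub>m Suc N * const_mat G)"
      by (simp add: poly_0_coeff_0 coeff_pderiv C_def del: pow_mat.simps)
  qed
qed

lemma degree_pencil_pow:
  assumes A: "A \<in> carrier_mat n n" and B: "B \<in> carrier_mat n n" and "i < n" "j < n"
  shows "degree ((pencil A B ^\<^sub>m N) $$ (i, j)) \<le> N"
  using assms(3,4)
proof (induction N arbitrary: i j)
  case 0
  thus ?case using B by simp
next
  case (Suc N)
  have *: "pencil A B \<in> carrier_mat n n" "pencil A B ^\<^sub>m N \<in> carrier_mat n n"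
    using B by auto
  have "degree (pencil A B $$ (l, j)) \<le> 1" if "l < n" for l
    using that Suc.prems by (simp add: pencil_index[OF A B])
  hence "degree ((pencil A B ^\<^sub>m N) $$ (i, l) * pencil A B $$ (l, j)) \<le> Suc N" if "l < n" for l
    using Suc.IH[of i l] Suc.prems that
    by (intro order.trans[OF degree_mult_le]) force
  moreover have "(pencil A B ^\<^sub>m Suc N) $$ (i, j) =
      (\<Sum>l\<in>{0..<n}. (pencil A B ^\<^sub>m N) $$ (i, l) * pencil A B $$ (l, j))"
    using * Suc.prems by (simp add: scalar_prod_def carrier_matD[OF B])
  ultimately show ?case
    by (simp only:) (intro degree_sum_le, auto)
qed

lemma degree_bmv_poly:
  assumes "A \<in> carrier_mat n n" "B \<in> carrier_mat n n"
  shows "degree (bmv_poly N A B) \<le> N"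
  using assms unfolding bmv_poly_eq mat_trace_def
  by (intro degree_sum_le) (auto intro!: degree_pencil_pow)

lemma smult_pow_mat:
  fixes A :: "'a :: comm_semiring_1 mat"
  assumes "A \<in> carrier_mat n n"
  shows "(c \<cdot>\<^sub>m A) ^\<^sub>m N = c ^ N \<cdot>\<^sub>m A ^\<^sub>m N"
proof (induction N)
  case 0
  show ?case using assms by (intro eq_matI) auto
next
  case (Suc N)
  show ?case
    using assms
    by (simp add: Suc.IH mult_smult_distrib[of _ n n _ n] mult_smult_assoc_mat[of _ n n _ n])
       (intro eq_matI, auto simp: mult.assoc mult.left_commute)
qed

text \<open>Homogeneity, from \<open>a A + t b B = a (A + (b / a) t B)\<close>: the substitution \<open>t \<mapsto> (b / a) t\<close> is a ring
  homomorphism, so it commutes with powers and traces.\<close>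
lemma coeff_bmv_poly_smult:
  fixes A B :: "complex mat"
  assumes A: "A \<in> carrier_mat n n" and B: "B \<in> carrier_mat n n" and "a \<noteq> 0" "k \<le> N"
  shows "coeff (bmv_poly N (a \<cdot>\<^sub>m A) (b \<cdot>\<^sub>m B)) k = a ^ (N - k) * b ^ k * coeff (bmv_poly N A B) k"
proof -
  define h where "h = (\<lambda>p :: complex poly. pcompose p [:0, b / a:])"
  have h: "semiring_hom h"
    unfolding h_def by unfold_locales (auto simp: pcompose_add pcompose_mult pcompose_1)
  have C: "pencil A B \<in> carrier_mat n n"
    using B by simp
  have "pencil (a \<cdot>\<^sub>m A) (b \<cdot>\<^sub>m B) = [:a:] \<cdot>\<^sub>m map_mat h (pencil A B)"
    using A B \<open>a \<noteq> 0\<close> by (intro eq_matI) (auto simp: pencil_index[of _ n] h_def pcompose_pCons)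
  hence "bmv_poly N (a \<cdot>\<^sub>m A) (b \<cdot>\<^sub>m B) = [:a:] ^ N * h (bmv_poly N A B)"
    using C unfolding bmv_poly_eq
    by (simp add: smult_pow_mat[of _ n] mat_trace_smult[of _ n]
          semiring_hom.mat_hom_pow[OF h, symmetric, of _ n] mat_trace_hom[OF h, of _ n])
  also have "[:a:] ^ N = [:a ^ N:]"
    by (induction N) (auto simp: one_pCons)
  finally have "coeff (bmv_poly N (a \<cdot>\<^sub>m A) (b \<cdot>\<^sub>m B)) k = a ^ N * ((b / a) ^ k * coeff (bmv_poly N A B) k)"
    by (simp add: h_def coeff_pcompose_linear)
  thus ?thesis
    using \<open>a \<noteq> 0\<close> \<open>k \<le> N\<close> by (simp add: power_diff power_divide)
qed

lemma mat_adjoint_carrier [simp]: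
  "A \<in> carrier_mat n m \<Longrightarrow> mat_adjoint A \<in> carrier_mat m n"
  unfolding mat_adjoint_def by (intro carrier_matI) auto

lemma mat_adjoint_dim [simp]:
  "dim_row (mat_adjoint A) = dim_col A" "dim_col (mat_adjoint A) = dim_row A"
  by (simp_all add: mat_adjoint_def)

lemma mat_adjoint_index:
  fixes A :: "complex mat"
  assumes "A \<in> carrier_mat n m" "i < m" "j < n"
  shows "mat_adjoint A $$ (i, j) = cnj (A $$ (j, i))"
  using assms by (auto simp: mat_adjoint_def mat_of_rows_index)

lemma hermitian_mat_iff:
  assumes "A \<in> carrier_mat n n"
  shows "hermitian_mat A \<longleftrightarrow> (\<forall>i<n. \<forall>j<n. A $$ (i, j) = cnj (A $$ (j, i)))"
proof
  assume "hermitian_mat A"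
  thus "\<forall>i<n. \<forall>j<n. A $$ (i, j) = cnj (A $$ (j, i))"
    using mat_adjoint_index[OF assms] by (metis hermitian_mat_def)
next
  assume "\<forall>i<n. \<forall>j<n. A $$ (i, j) = cnj (A $$ (j, i))"
  hence "mat_adjoint A $$ (i, j) = A $$ (i, j)" if "i < n" "j < n" for i j
    using that mat_adjoint_index[OF assms that] by metis
  hence "mat_adjoint A = A"
    using carrier_matD[OF mat_adjoint_carrier[OF assms]] carrier_matD[OF assms]
    by (intro eq_matI) auto
  thus "hermitian_mat A"
    using assms by (simp add: hermitian_mat_def)
qed

lemma transpose_pow_mat:
  fixes A :: "'a :: comm_semiring_1 mat"
  assumes "A \<in> carrier_mat n n"
  shows "transpose_mat (A ^\<^sub>m N) = transpose_mat A ^\<^sub>m N"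
proof (induction N)
  case (Suc N)
  have "transpose_mat (A ^\<^sub>m Suc N) = transpose_mat A * transpose_mat (A ^\<^sub>m N)"
    using assms by (simp add: transpose_mult[of _ n n _ n])
  thus ?case
    using assms unfolding Suc.IH by (subst pow_mat_Suc_left[of _ n]) auto
qed (use assms in auto)

text \<open>Conjugating the coefficients turns the pencil of two Hermitian matrices into its transpose, and
  a power of the transpose has the same trace.\<close>
lemma Im_coeff_bmv_poly_hermitian:
  assumes A: "A \<in> carrier_mat n n" "hermitian_mat A" and B: "B \<in> carrier_mat n n" "hermitian_mat B"
  shows "Im (coeff (bmv_poly N A B) k) = 0"
proof -
  define h where "h = (map_poly cnj :: complex poly \<Rightarrow> complex poly)"
  have h: "semiring_hom h"
    unfolding h_def
    by unfold_locales (auto intro!: poly_eqI simp: coeff_map_poly coeff_mult cnj_sum)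
  have C: "pencil A B \<in> carrier_mat n n"
    using B by simp
  have "cnj (A $$ (i, j)) = A $$ (j, i)" "cnj (B $$ (i, j)) = B $$ (j, i)" if "i < n" "j < n" for i j
    using A B that hermitian_mat_iff by metis+
  hence "map_mat h (pencil A B) = transpose_mat (pencil A B)"
    using A B C by (intro eq_matI) (auto simp: pencil_index[of _ n] h_def map_poly_pCons)
  hence "h (bmv_poly N A B) = mat_trace (transpose_mat (pencil A B ^\<^sub>m N))"
    using C unfolding bmv_poly_eq
    by (simp add: mat_trace_hom[OF h, symmetric, of _ n] semiring_hom.mat_hom_pow[OF h, of _ n]
         transpose_pow_mat)
  also have "\<dots> = bmv_poly N A B"
    using carrier_matD[OF C] by (simp add: bmv_poly_eq mat_trace_def)
  finally have "cnj (coeff (bmv_poly N A B) k) = coeff (bmv_poly N A B) k"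
    by (metis h_def coeff_map_poly complex_cnj_zero)
  thus ?thesis
    by (simp add: complex_eq_iff)
qed

lemma bmv_poly_1:
  assumes "A \<in> carrier_mat n n" "B \<in> carrier_mat n n"
  shows "bmv_poly (Suc 0) A B = [:mat_trace A, mat_trace B:]"
  using assms by (intro poly_eqI)
    (auto simp: bmv_poly_eq mat_trace_def pencil_index[of _ n] coeff_sum coeff_pCons sum.neutral split: nat.split)

section \<open>Positive semidefinite matrices\<close>

text \<open>Matrices and vectors enter as functions on indices, so that the pivot elimination below can
  change entries without carrying dimensions along.\<close>
definition hform :: "nat \<Rightarrow> (nat \<Rightarrow> nat \<Rightarrow> complex) \<Rightarrow> (nat \<Rightarrow> complex) \<Rightarrow> (nat \<Rightarrow> complex) \<Rightarrow> complex" where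
  "hform n h x y = (\<Sum>i<n. \<Sum>j<n. cnj (x i) * h i j * y j)"

definition hermitian_psd :: "nat \<Rightarrow> (nat \<Rightarrow> nat \<Rightarrow> complex) \<Rightarrow> bool" where
  "hermitian_psd n h \<longleftrightarrow> (\<forall>i<n. \<forall>j<n. cnj (h i j) = h j i) \<and> (\<forall>x. 0 \<le> Re (hform n h x x))"

lemma hform_right: "hform n h x (\<lambda>i. y i + c * z i) = hform n h x y + c * hform n h x z"
  by (simp add: hform_def sum.distrib sum_distrib_left algebra_simps)

lemma hform_left: "hform n h (\<lambda>i. x i + c * z i) y = hform n h x y + cnj c * hform n h z y"
  by (simp add: hform_def sum.distrib sum_distrib_left algebra_simps)

lemma cnj_hform:
  assumes "\<And>i j. i < n \<Longrightarrow> j < n \<Longrightarrow> cnj (h i j) = h j i"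
  shows "cnj (hform n h x y) = hform n h y x"
proof -
  have "cnj (hform n h x y) = (\<Sum>i<n. \<Sum>j<n. x i * h j i * cnj (y j))"
    using assms by (simp add: hform_def cnj_sum)
  also have "\<dots> = hform n h y x"
    unfolding hform_def by (subst sum.swap) (simp add: mult_ac)
  finally show ?thesis .
qed

text \<open>The form may be degenerate. Evaluating it at \<open>y - r \<langle>x, y\<rangle> x\<close> for real \<open>r\<close> gives a quadratic
  polynomial in \<open>r\<close> that is nonnegative; take \<open>r\<close> to be its minimizer if the form does not vanish at
  \<open>x\<close>, and \<open>r\<close> large otherwise.\<close>
lemma hform_Cauchy_Schwarz:
  assumes h: "hermitian_psd n h"
  shows "(cmod (hform n h x y))\<^sup>2 \<le> Re (hform n h x x) * Re (hform n h y y)"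
proof -
  define a b c where "a = Re (hform n h x x)" "b = Re (hform n h y y)" "c = hform n h x y"
  note abc = this
  have pos: "0 \<le> Re (hform n h z z)" for z
    using h by (simp add: hermitian_psd_def)
  have cnj: "hform n h y x = cnj c"
    using h by (simp add: abc cnj_hform hermitian_psd_def)
  have *: "0 \<le> b - 2 * r * (cmod c)\<^sup>2 + r\<^sup>2 * (cmod c)\<^sup>2 * a" for r :: real
  proof -
    define t where "t = - complex_of_real r * c"
    have "0 \<le> Re (hform n h (\<lambda>i. y i + t * x i) (\<lambda>i. y i + t * x i))"
      by (rule pos)
    also have "hform n h (\<lambda>i. y i + t * x i) (\<lambda>i. y i + t * x i) =
        hform n h y y + (t * cnj c + cnj t * c) + cnj t * t * hform n h x x"
      by (simp add: hform_left hform_right cnj abc(3)[symmetric] algebra_simps)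
    also have "t * cnj c + cnj t * c = complex_of_real (- 2 * r * (cmod c)\<^sup>2)"
      by (simp add: t_def complex_norm_square algebra_simps del: of_real_power)
    also have "cnj t * t = complex_of_real (r\<^sup>2 * (cmod c)\<^sup>2)"
      by (simp add: t_def complex_norm_square power2_eq_square[of r] algebra_simps del: of_real_power)
    finally show ?thesis
      by (simp add: abc del: of_real_mult of_real_power)
  qed
  show ?thesis
  proof (cases "a = 0")
    case True
    have "c = 0"
    proof (rule ccontr)
      assume "c \<noteq> 0"
      thus False
        using *[of "(b + 1) / (2 * (cmod c)\<^sup>2)"] True by simp
    qed
    thus ?thesis using True by (simp add: abc)
  next
    case False
    hence "a > 0" using pos[of x] by (simp add: abc)
    thus ?thesis
      using *[of "1 / a"] by (simp add: abc[symmetric] power2_eq_square field_simps)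
  qed
qed

definition unit_fun :: "nat \<Rightarrow> nat \<Rightarrow> complex" where
  "unit_fun k i = (if i = k then 1 else 0)"

lemma hform_unit_left:
  assumes "k < n"
  shows "hform n h (unit_fun k) x = (\<Sum>j<n. h k j * x j)"
proof -
  have "hform n h (unit_fun k) x = (\<Sum>i<n. if i = k then \<Sum>j<n. h k j * x j else 0)"
    unfolding hform_def unit_fun_def by (intro sum.cong) auto
  thus ?thesis using assms by simp
qed

lemma hform_unit_unit:
  assumes "k < n" "l < n"
  shows "hform n h (unit_fun k) (unit_fun l) = h k l"
proof -
  have "(\<Sum>j<n. h k j * unit_fun l j) = (\<Sum>j<n. if j = l then h k l else 0)"
    unfolding unit_fun_def by (intro sum.cong) auto
  thus ?thesis using assms by (simp add: hform_unit_left)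
qed

text \<open>Cholesky elimination of the \<open>k\<close>-th row and column. Subtracting the rank-one matrix
  \<open>h i k * h k j / h k k\<close> leaves a positive semidefinite form, which is just the Cauchy-Schwarz inequality
  against the \<open>k\<close>-th unit vector. If the pivot \<open>h k k\<close> is \<open>0\<close>, the same inequality shows that its row
  already vanishes, and the convention \<open>x / 0 = 0\<close> makes the step trivial.\<close>
lemma hermitian_psd_factor_aux:
  assumes "hermitian_psd n h" "k \<le> n"
    and "\<And>i j. i < n \<Longrightarrow> j < n \<Longrightarrow> i < k \<or> j < k \<Longrightarrow> h i j = 0"
  shows "\<exists>x. \<forall>i<n. \<forall>j<n. h i j = (\<Sum>l\<in>{k..<n}. x i l * cnj (x j l))"
  using assms
proof (induction "n - k" arbitrary: h k)
  case 0
  thus ?case by auto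
next
  case (Suc d)
  hence k: "k < n" by simp
  have herm: "cnj (h i j) = h j i" if "i < n" "j < n" for i j
    using Suc.prems(1) that by (auto simp: hermitian_psd_def)
  define a where "a = Re (h k k)"
  have hkk: "h k k = complex_of_real a"
    using herm[OF k k] by (auto simp: a_def complex_eq_iff)
  have CS: "(cmod (hform n h (unit_fun k) x))\<^sup>2 \<le> a * Re (hform n h x x)" for x
    using hform_Cauchy_Schwarz[OF Suc.prems(1), of "unit_fun k" x] k
    by (simp add: hform_unit_unit a_def)
  have "a \<ge> 0"
    using Suc.prems(1) k hform_unit_unit[of k n k h] by (metis a_def hermitian_psd_def)
  define h' where "h' = (\<lambda>i j. h i j - h i k * h k j / complex_of_real a)"
  have hform': "hform n h' x x = hform n h x x - complex_of_real ((cmod (hform n h (unit_fun k) x))\<^sup>2 / a)" for x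
  proof -
    define q where "q = hform n h (unit_fun k) x"
    have q: "q = (\<Sum>j<n. h k j * x j)"
      using k by (simp add: q_def hform_unit_left)
    have q': "cnj q = (\<Sum>i<n. cnj (x i) * h i k)"
      unfolding q using herm k by (auto simp: cnj_sum intro!: sum.cong)
    have "hform n h' x x = hform n h x x - (\<Sum>i<n. \<Sum>j<n. cnj (x i) * h i k * (h k j * x j)) / complex_of_real a"
      by (simp add: hform_def h'_def sum_subtractf sum_divide_distrib algebra_simps)
    also have "(\<Sum>i<n. \<Sum>j<n. cnj (x i) * h i k * (h k j * x j)) = cnj q * q"
      unfolding q' unfolding q by (simp add: sum_product)
    finally show ?thesis
      by (simp add: q_def complex_norm_square mult.commute del: of_real_power)
  qed
  have "hermitian_psd n h'"
    unfolding hermitian_psd_def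
  proof (intro conjI allI impI)
    show "cnj (h' i j) = h' j i" if "i < n" "j < n" for i j
      using herm k that by (simp add: h'_def mult.commute)
    show "0 \<le> Re (hform n h' x x)" for x
    proof (cases "a = 0")
      case True
      thus ?thesis using Suc.prems(1) unfolding hform' by (simp add: hermitian_psd_def)
    next
      case False
      thus ?thesis using CS[of x] \<open>a \<ge> 0\<close> unfolding hform' by (simp add: field_simps)
    qed
  qed
  moreover have "h' i j = 0" if ij: "i < n" "j < n" "i < Suc k \<or> j < Suc k" for i j
  proof -
    have row: "h' k j = 0" if "j < n" for j
    proof (cases "a = 0")
      case True
      hence "h k j = 0"
        using CS[of "unit_fun j"] k that by (simp add: hform_unit_unit)
      thus ?thesis using True by (simp add: h'_def)
    next
      case False
      thus ?thesis by (simp add: h'_def hkk)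
    qed
    have "h' i k = 0" if "i < n" for i
      using row[OF that] herm that k
      by (metis \<open>hermitian_psd n h'\<close> complex_cnj_zero hermitian_psd_def)
    thus ?thesis
      using row ij k Suc.prems(3)[of i j] Suc.prems(3)[of i k] Suc.prems(3)[of k j]
      by (auto simp: less_Suc_eq h'_def)
  qed
  moreover have "d = n - Suc k"
    using Suc.hyps(2) by simp
  ultimately obtain x' where x': "\<And>i j. i < n \<Longrightarrow> j < n \<Longrightarrow> h' i j = (\<Sum>l\<in>{Suc k..<n}. x' i l * cnj (x' j l))"
    using Suc.hyps(1)[of "Suc k" h'] k by (metis Suc_leI)
  define x where "x = (\<lambda>i l. if l = k then h i k / complex_of_real (sqrt a) else x' i l)"
  have "h i j = (\<Sum>l\<in>{k..<n}. x i l * cnj (x j l))" if "i < n" "j < n" for i j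
  proof -
    have "(\<Sum>l\<in>{k..<n}. x i l * cnj (x j l)) = x i k * cnj (x j k) + (\<Sum>l\<in>{Suc k..<n}. x i l * cnj (x j l))"
      using k by (rule sum.atLeast_Suc_lessThan)
    also have "(\<Sum>l\<in>{Suc k..<n}. x i l * cnj (x j l)) = h' i j"
      unfolding x'[OF that] by (intro sum.cong) (auto simp: x_def)
    also have "x i k * cnj (x j k) = h i k * h k j / complex_of_real a"
    proof -
      have "complex_of_real (sqrt a) * complex_of_real (sqrt a) = complex_of_real a"
        using \<open>a \<ge> 0\<close> by (metis of_real_mult abs_of_nonneg real_sqrt_mult_self)
      thus ?thesis
        using herm k that by (simp add: x_def times_divide_times_eq)
    qed
    finally show ?thesis by (simp add: h'_def)
  qed
  thus ?case by blast
qed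

text \<open>Coordinates outside \<open>I\<close> are irrelevant to the vectors represented; bounding them too makes the
  set compact in the product topology, and it spares types that depend on the dimension.\<close>
definition l2_sphere :: "'i set \<Rightarrow> ('i \<Rightarrow> complex) set" where
  "l2_sphere I = {x. (\<forall>i. cmod (x i) \<le> 1) \<and> (\<Sum>i\<in>I. (cmod (x i))\<^sup>2) = 1}"

lemma compact_l2_sphere: "compact (l2_sphere I :: ('i \<Rightarrow> complex) set)"
proof -
  have "compactin (product_topology (\<lambda>_ :: 'i. euclidean) UNIV) (PiE UNIV (\<lambda>_. cball (0 :: complex) 1))"
    by (simp add: compactin_PiE)
  hence "compact (PiE UNIV (\<lambda>_ :: 'i. cball (0 :: complex) 1))"
    by (simp add: euclidean_product_topology)
  moreover have "closed {x :: 'i \<Rightarrow> complex. (\<Sum>i\<in>I. (cmod (x i))\<^sup>2) = 1}"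
    by (intro closed_Collect_eq continuous_intros continuous_on_product_coordinates)
  moreover have "l2_sphere I = PiE UNIV (\<lambda>_ :: 'i. cball (0 :: complex) 1) \<inter> {x. (\<Sum>i\<in>I. (cmod (x i))\<^sup>2) = 1}"
    by (auto simp: l2_sphere_def PiE_def Pi_def)
  ultimately show ?thesis
    by (simp add: compact_Int_closed)
qed

lemma continuous_on_apply:
  "continuous_on S (\<lambda>x :: 'i \<Rightarrow> 'b :: topological_space. x i)"
  by (rule continuous_on_subset[OF continuous_on_product_coordinates]) simp

lemma l2_sphere_normalize:
  assumes "finite I" "r > 0" "r\<^sup>2 = (\<Sum>i\<in>I. (cmod (x i))\<^sup>2)"
  shows "(\<lambda>i. if i \<in> I then x i / complex_of_real r else 0) \<in> l2_sphere I"
proof -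
  have "cmod (x i) \<le> r" if "i \<in> I" for i
  proof -
    have "(cmod (x i))\<^sup>2 \<le> r\<^sup>2"
      unfolding assms(3) using assms(1) that by (intro member_le_sum) auto
    thus ?thesis using assms(2) by (simp add: power2_le_iff_abs_le)
  qed
  moreover have "(\<Sum>i\<in>I. (cmod (x i))\<^sup>2) \<noteq> 0"
    using assms(2) unfolding assms(3)[symmetric] by simp
  hence "(\<Sum>i\<in>I. (cmod (x i / complex_of_real r))\<^sup>2) = 1"
    using assms by (simp add: norm_divide power_divide sum_divide_distrib[symmetric])
  ultimately show ?thesis
    using assms by (auto simp: l2_sphere_def norm_divide)
qed

text \<open>Let the form attain its minimum \<open>m\<close> over the unit sphere at \<open>u\<close>. The form of \<open>A - m\<close> is positive
  semidefinite and vanishes at \<open>u\<close>, so by Cauchy-Schwarz \<open>u\<close> lies in its radical: \<open>m\<close> is an eigenvalue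
  of \<open>A\<close>, hence nonnegative.\<close>
lemma hermitian_psd_if_psd_mat:
  assumes A: "A \<in> carrier_mat n n" and psd: "psd_mat A"
  shows "hermitian_psd n (\<lambda>i j. A $$ (i, j))"
proof (cases "n = 0")
  case True
  thus ?thesis by (simp add: hermitian_psd_def hform_def)
next
  case False
  define h where "h = (\<lambda>i j. A $$ (i, j))"
  define N where "N = (\<lambda>x :: nat \<Rightarrow> complex. \<Sum>i<n. (cmod (x i))\<^sup>2)"
  have herm: "cnj (h i j) = h j i" if "i < n" "j < n" for i j
    using psd that A hermitian_mat_iff[OF A] unfolding h_def psd_mat_def by metis
  have nonempty: "unit_fun 0 \<in> l2_sphere {..<n}"
    using False by (auto simp: l2_sphere_def unit_fun_def if_distrib[of cmod] if_distrib[of "\<lambda>x. x\<^sup>2"] cong: if_cong)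
  have "continuous_on (l2_sphere {..<n}) (\<lambda>x. Re (hform n h x x))"
    unfolding hform_def by (intro continuous_intros continuous_on_apply)
  then obtain u where u: "u \<in> l2_sphere {..<n}"
      and min: "\<And>x. x \<in> l2_sphere {..<n} \<Longrightarrow> Re (hform n h u u) \<le> Re (hform n h x x)"
    using continuous_attains_inf[OF compact_l2_sphere, of "{..<n}" "\<lambda>x. Re (hform n h x x)"] nonempty
    by blast
  define m where "m = Re (hform n h u u)"
  have lower: "m * N x \<le> Re (hform n h x x)" for x
  proof (cases "N x = 0")
    case True
    hence "x i = 0" if "i < n" for i
      using that by (simp add: N_def sum_nonneg_eq_0_iff)
    thus ?thesis using True by (simp add: hform_def)
  next
    case False
    define r where "r = sqrt (N x)"
    have "N x \<ge> 0" by (auto simp: N_def intro: sum_nonneg)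
    hence r: "r > 0" "r\<^sup>2 = N x" using False by (simp_all add: r_def)
    have "m \<le> Re (hform n h (\<lambda>i. if i \<in> {..<n} then x i / complex_of_real r else 0)
                           (\<lambda>i. if i \<in> {..<n} then x i / complex_of_real r else 0))"
      unfolding m_def using r by (intro min l2_sphere_normalize) (auto simp: N_def)
    also have "hform n h (\<lambda>i. if i \<in> {..<n} then x i / complex_of_real r else 0)
                         (\<lambda>i. if i \<in> {..<n} then x i / complex_of_real r else 0) =
               hform n h x x / complex_of_real (r\<^sup>2)"
      by (simp add: hform_def sum_divide_distrib power2_eq_square)
    finally show ?thesis
      using r False \<open>N x \<ge> 0\<close> by (simp add: pos_le_divide_eq)
  qed
  define h' where "h' = (\<lambda>i j. h i j - (if i = j then complex_of_real m else 0))"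
  have hform': "hform n h' x y = hform n h x y - complex_of_real m * (\<Sum>i<n. cnj (x i) * y i)" for x y
  proof -
    have "hform n h' x y = hform n h x y - (\<Sum>i<n. \<Sum>j<n. if i = j then complex_of_real m * (cnj (x i) * y i) else 0)"
      unfolding hform_def h'_def sum_subtractf[symmetric] by (intro sum.cong) (auto simp: algebra_simps)
    thus ?thesis by (simp add: sum_distrib_left)
  qed
  have N: "complex_of_real (N x) = (\<Sum>i<n. cnj (x i) * x i)" for x
    by (simp add: N_def complex_norm_square mult.commute del: of_real_power)
  have "hermitian_psd n h'"
    unfolding hermitian_psd_def
  proof (intro conjI allI impI)
    show "cnj (h' i j) = h' j i" if "i < n" "j < n" for i j
      using herm that by (simp add: h'_def)
    show "0 \<le> Re (hform n h' x x)" for x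
      using lower[of x] unfolding hform' N[symmetric] by simp
  qed
  moreover have "Re (hform n h' u u) = 0"
    using u unfolding hform' N[symmetric] by (simp add: m_def N_def l2_sphere_def)
  ultimately have kernel: "hform n h' x u = 0" for x
    using hform_Cauchy_Schwarz[of n h' x u] by simp
  define v where "v = vec n u"
  have "A *\<^sub>v v = complex_of_real m \<cdot>\<^sub>v v"
  proof (intro eq_vecI)
    fix i assume "i < dim_vec (complex_of_real m \<cdot>\<^sub>v v)"
    hence i: "i < n" by (simp add: v_def)
    have "(\<Sum>j<n. cnj (unit_fun i j) * u j) = (\<Sum>j<n. if j = i then u i else 0)"
      by (intro sum.cong) (auto simp: unit_fun_def)
    hence "(\<Sum>j<n. h i j * u j) = complex_of_real m * u i"
      using kernel[of "unit_fun i"] i unfolding hform' by (simp add: hform_unit_left)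
    thus "(A *\<^sub>v v) $ i = (complex_of_real m \<cdot>\<^sub>v v) $ i"
      using A i by (simp add: v_def scalar_prod_def h_def atLeast0LessThan)
  qed (use A in \<open>auto simp: v_def\<close>)
  moreover have "v \<noteq> 0\<^sub>v n"
  proof
    assume "v = 0\<^sub>v n"
    hence "u i = 0" if "i < n" for i
      using that by (metis index_vec index_zero_vec(1) v_def)
    thus False using u by (simp add: l2_sphere_def)
  qed
  ultimately have "eigenvalue A (complex_of_real m)"
    using A unfolding eigenvalue_def eigenvector_def by (intro exI[of _ v]) (simp add: v_def)
  hence "m \<ge> 0"
    using psd by (metis nonneg_Reals_of_real_iff psd_mat_def)
  moreover have "N x \<ge> 0" for x
    by (auto simp: N_def intro: sum_nonneg)
  ultimately have "0 \<le> Re (hform n h x x)" for x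
    using lower[of x] by (meson mult_nonneg_nonneg order.trans)
  thus ?thesis
    using herm unfolding h_def by (simp add: hermitian_psd_def)
qed

lemma psd_mat_factor:
  assumes A: "A \<in> carrier_mat n n" and psd: "psd_mat A"
  obtains X where "X \<in> carrier_mat n n" "A = X * mat_adjoint X"
proof -
  obtain x where x: "\<And>i j. i < n \<Longrightarrow> j < n \<Longrightarrow> A $$ (i, j) = (\<Sum>l\<in>{0..<n}. x i l * cnj (x j l))"
    using hermitian_psd_factor_aux[OF hermitian_psd_if_psd_mat[OF assms], of 0] by auto
  define X where "X = mat n n (\<lambda>(i, j). x i j)"
  have X: "X \<in> carrier_mat n n" by (simp add: X_def)
  have Xi: "X $$ (i, l) = x i l" if "i < n" "l < n" for i l
    using that by (simp add: X_def)
  have "A = X * mat_adjoint X"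
  proof (rule eq_matI)
    fix i j assume "i < dim_row (X * mat_adjoint X)" "j < dim_col (X * mat_adjoint X)"
    hence ij: "i < n" "j < n"
      using carrier_matD[OF X] carrier_matD[OF mat_adjoint_carrier[OF X]] by auto
    have "(X * mat_adjoint X) $$ (i, j) = (\<Sum>l\<in>{0..<n}. X $$ (i, l) * mat_adjoint X $$ (l, j))"
      using carrier_matD[OF X] carrier_matD[OF mat_adjoint_carrier[OF X]] ij by (simp add: scalar_prod_def)
    also have "\<dots> = (\<Sum>l\<in>{0..<n}. x i l * cnj (x j l))"
      using ij by (intro sum.cong) (simp_all add: mat_adjoint_index[OF X] Xi)
    finally show "A $$ (i, j) = (X * mat_adjoint X) $$ (i, j)"
      by (simp add: x ij)
  qed (use A carrier_matD[OF X] carrier_matD[OF mat_adjoint_carrier[OF X]] in auto)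
  thus ?thesis using X that by blast
qed

text \<open>For the remaining direction, an eigenvector \<open>v\<close> with eigenvalue \<open>e\<close> gives the form the value
  \<open>e |v|\<^sup>2\<close>.\<close>
lemma psd_mat_iff_hermitian_psd:
  assumes A: "A \<in> carrier_mat n n"
  shows "psd_mat A \<longleftrightarrow> hermitian_psd n (\<lambda>i j. A $$ (i, j))"
proof
  assume psd: "hermitian_psd n (\<lambda>i j. A $$ (i, j))"
  have "hermitian_mat A"
    unfolding hermitian_mat_iff[OF A] using psd unfolding hermitian_psd_def by metis
  moreover have "e \<in> \<real>\<^sub>\<ge>\<^sub>0" if ev: "eigenvalue A e" for e
  proof -
    obtain v where v: "v \<in> carrier_vec n" "v \<noteq> 0\<^sub>v n" "A *\<^sub>v v = e \<cdot>\<^sub>v v"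
      using ev A by (auto simp: eigenvalue_def eigenvector_def)
    define N where "N = (\<Sum>i<n. (cmod (v $ i))\<^sup>2)"
    define q where "q = hform n (\<lambda>i j. A $$ (i, j)) (\<lambda>i. v $ i) (\<lambda>i. v $ i)"
    obtain i where "i < n" "v $ i \<noteq> 0"
      using v(1,2) by (metis carrier_vecD eq_vecI index_zero_vec)
    hence N: "N > 0"
      unfolding N_def by (intro sum_pos2[of _ i]) auto
    have row: "(\<Sum>j<n. A $$ (i, j) * v $ j) = e * v $ i" if "i < n" for i
    proof -
      have "(A *\<^sub>v v) $ i = (\<Sum>j<n. A $$ (i, j) * v $ j)"
        using A v(1) that by (simp add: scalar_prod_def atLeast0LessThan)
      thus ?thesis using v(1,3) that by simp
    qed
    have "q = (\<Sum>i<n. cnj (v $ i) * (\<Sum>j<n. A $$ (i, j) * v $ j))"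
      by (simp add: q_def hform_def sum_distrib_left mult.assoc)
    also have "\<dots> = (\<Sum>i<n. e * complex_of_real ((cmod (v $ i))\<^sup>2))"
      using row by (intro sum.cong) (simp_all add: complex_norm_square mult_ac del: of_real_power)
    finally have q: "q = e * complex_of_real N"
      by (simp add: N_def sum_distrib_left)
    have "cnj q = q" "Re q \<ge> 0"
      using psd by (simp_all add: q_def hermitian_psd_def cnj_hform)
    hence "q = complex_of_real (Re q)" "Re q \<ge> 0"
      by (auto simp: complex_eq_iff)
    moreover have "e = q / complex_of_real N"
      using N q by simp
    ultimately have "e = complex_of_real (Re q / N)" "Re q / N \<ge> 0"
      using N by (metis of_real_divide, simp)
    thus ?thesis
      by (metis nonneg_Reals_of_real_iff)
  qed
  ultimately show "psd_mat A"
    by (simp add: psd_mat_def)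
qed (rule hermitian_psd_if_psd_mat[OF A])

lemma psd_mat_imp_hermitian: "psd_mat A \<Longrightarrow> hermitian_mat A"
  by (simp add: psd_mat_def)

lemma psd_mat_mult_adjoint:
  assumes X: "X \<in> carrier_mat n n"
  shows "psd_mat (X * mat_adjoint X)"
proof -
  have carrier: "X * mat_adjoint X \<in> carrier_mat n n"
    using X by simp
  have entry: "(X * mat_adjoint X) $$ (i, j) = (\<Sum>l<n. X $$ (i, l) * cnj (X $$ (j, l)))"
    if "i < n" "j < n" for i j
    using carrier_matD[OF X] carrier_matD[OF mat_adjoint_carrier[OF X]] that
    by (simp add: scalar_prod_def atLeast0LessThan mat_adjoint_index[OF X])
  show ?thesis
    unfolding psd_mat_iff_hermitian_psd[OF carrier] hermitian_psd_def
  proof (intro conjI allI impI)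
    show "cnj ((X * mat_adjoint X) $$ (i, j)) = (X * mat_adjoint X) $$ (j, i)" if "i < n" "j < n" for i j
      using that by (simp add: entry mult.commute)
    fix x
    have "hform n (\<lambda>i j. (X * mat_adjoint X) $$ (i, j)) x x =
      (\<Sum>i<n. \<Sum>j<n. \<Sum>l<n. (cnj (x i) * X $$ (i, l)) * (cnj (X $$ (j, l)) * x j))"
      unfolding hform_def by (intro sum.cong) (simp_all add: entry sum_distrib_left sum_distrib_right mult_ac)
    also have "\<dots> = (\<Sum>i<n. \<Sum>l<n. \<Sum>j<n. (cnj (x i) * X $$ (i, l)) * (cnj (X $$ (j, l)) * x j))"
      by (intro sum.cong refl sum.swap)
    also have "\<dots> = (\<Sum>l<n. \<Sum>i<n. \<Sum>j<n. (cnj (x i) * X $$ (i, l)) * (cnj (X $$ (j, l)) * x j))"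
      by (rule sum.swap)
    also have "\<dots> = (\<Sum>l<n. (\<Sum>i<n. cnj (x i) * X $$ (i, l)) * cnj (\<Sum>j<n. cnj (x j) * X $$ (j, l)))"
      unfolding cnj_sum sum_product by (simp add: mult_ac)
    also have "\<dots> = complex_of_real (\<Sum>l<n. (cmod (\<Sum>i<n. cnj (x i) * X $$ (i, l)))\<^sup>2)"
      by (simp add: complex_norm_square del: of_real_power cnj_sum)
    finally show "0 \<le> Re (hform n (\<lambda>i j. (X * mat_adjoint X) $$ (i, j)) x x)"
      by (simp add: sum_nonneg)
  qed
qed

lemma mat_trace_mult_adjoint:
  assumes X: "X \<in> carrier_mat n n"
  shows "mat_trace (X * mat_adjoint X) = complex_of_real (\<Sum>p\<in>{..<n} \<times> {..<n}. (cmod (X $$ p))\<^sup>2)"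
proof -
  have "mat_trace (X * mat_adjoint X) = (\<Sum>i<n. \<Sum>j<n. complex_of_real ((cmod (X $$ (i, j)))\<^sup>2))"
    unfolding mat_trace_mult[OF X mat_adjoint_carrier[OF X]]
    by (intro sum.cong) (simp_all add: mat_adjoint_index[OF X] complex_norm_square del: of_real_power)
  thus ?thesis
    by (simp add: sum.cartesian_product case_prod_unfold)
qed

lemma mat_trace_psd:
  assumes "A \<in> carrier_mat n n" "psd_mat A"
  shows "mat_trace A = complex_of_real (Re (mat_trace A))" "Re (mat_trace A) \<ge> 0"
proof -
  obtain X where X: "X \<in> carrier_mat n n" "A = X * mat_adjoint X"
    using psd_mat_factor assms by metis
  show "mat_trace A = complex_of_real (Re (mat_trace A))" "Re (mat_trace A) \<ge> 0"
    unfolding X(2) mat_trace_mult_adjoint[OF X(1)] by (auto intro: sum_nonneg)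
qed

text \<open>With \<open>A = X X*\<close>, the trace \<open>Tr(X* B X)\<close> is the sum of the values of the form of \<open>B\<close> at the
  columns of \<open>X\<close>.\<close>
lemma mat_trace_mult_psd_nonneg:
  assumes A: "A \<in> carrier_mat n n" "psd_mat A" and B: "B \<in> carrier_mat n n" "psd_mat B"
  shows "0 \<le> Re (mat_trace (A * B))"
proof -
  obtain X where X: "X \<in> carrier_mat n n" "A = X * mat_adjoint X"
    using psd_mat_factor A by metis
  have "mat_trace (A * B) = mat_trace (X * (mat_adjoint X * B))"
    unfolding X(2) using X(1) B(1) by (simp add: assoc_mult_mat[of _ n n _ n _ n])
  also have "\<dots> = mat_trace (mat_adjoint X * (B * X))"
    using X(1) B(1)
    by (subst mat_trace_mult_comm[of _ n n]) (simp_all add: assoc_mult_mat[of _ n n _ n _ n])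
  also have "\<dots> = (\<Sum>l<n. \<Sum>i<n. mat_adjoint X $$ (l, i) * (B * X) $$ (i, l))"
    using X(1) B(1) by (intro mat_trace_mult) auto
  also have "\<dots> = (\<Sum>l<n. hform n (\<lambda>i j. B $$ (i, j)) (\<lambda>i. X $$ (i, l)) (\<lambda>i. X $$ (i, l)))"
    unfolding hform_def
    using carrier_matD[OF X(1)] carrier_matD[OF B(1)]
    by (intro sum.cong)
       (simp_all add: mat_adjoint_index[OF X(1)] scalar_prod_def atLeast0LessThan sum_distrib_left mult.assoc)
  finally show ?thesis
    using B(2) unfolding psd_mat_iff_hermitian_psd[OF B(1)] hermitian_psd_def
    by (auto intro: sum_nonneg)
qed

lemma mat_trace_square_pos:
  assumes A: "A \<in> carrier_mat n n" "hermitian_mat A" and "mat_trace A \<noteq> 0"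
  shows "0 < Re (mat_trace (A * A))"
proof -
  have herm: "cnj (A $$ (i, j)) = A $$ (j, i)" if "i < n" "j < n" for i j
    using A that hermitian_mat_iff by metis
  have "mat_trace (A * A) = (\<Sum>i<n. \<Sum>j<n. complex_of_real ((cmod (A $$ (i, j)))\<^sup>2))"
    unfolding mat_trace_mult[OF A(1) A(1)]
    by (intro sum.cong) (simp_all add: herm complex_norm_square del: of_real_power)
  hence eq: "Re (mat_trace (A * A)) = (\<Sum>i<n. \<Sum>j<n. (cmod (A $$ (i, j)))\<^sup>2)"
    by simp
  obtain i where i: "i < n" "A $$ (i, i) \<noteq> 0"
    using \<open>mat_trace A \<noteq> 0\<close> A(1) by (auto simp: mat_trace_def elim: sum.not_neutral_contains_not_neutral)
  have "0 < (\<Sum>j<n. (cmod (A $$ (i, j)))\<^sup>2)"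
    using i by (intro sum_pos2[of _ i]) auto
  thus ?thesis
    unfolding eq using i by (intro sum_pos2[of _ i]) (auto intro: sum_nonneg)
qed

lemma mat_adjoint_mult:
  fixes X Y :: "complex mat"
  assumes X: "X \<in> carrier_mat n n" and Y: "Y \<in> carrier_mat n n"
  shows "mat_adjoint (X * Y) = mat_adjoint Y * mat_adjoint X"
proof (rule eq_matI)
  note dims = carrier_matD[OF X] carrier_matD[OF Y]
    carrier_matD[OF mat_adjoint_carrier[OF X]] carrier_matD[OF mat_adjoint_carrier[OF Y]]
  fix i j assume "i < dim_row (mat_adjoint Y * mat_adjoint X)" "j < dim_col (mat_adjoint Y * mat_adjoint X)"
  hence ij: "i < n" "j < n" using dims by auto
  have "mat_adjoint (X * Y) $$ (i, j) = cnj ((X * Y) $$ (j, i))"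
    using X Y ij by (intro mat_adjoint_index) auto
  also have "\<dots> = (mat_adjoint Y * mat_adjoint X) $$ (i, j)"
    using ij dims
    by (auto simp: scalar_prod_def cnj_sum mat_adjoint_index[OF X] mat_adjoint_index[OF Y] mult.commute intro!: sum.cong)
  finally show "mat_adjoint (X * Y) $$ (i, j) = (mat_adjoint Y * mat_adjoint X) $$ (i, j)" .
qed auto

lemma psd_mat_congruence:
  assumes A: "A \<in> carrier_mat n n" "psd_mat A" and Y: "Y \<in> carrier_mat n n" "hermitian_mat Y"
  shows "psd_mat (Y * A * Y)"
proof -
  obtain X where X: "X \<in> carrier_mat n n" "A = X * mat_adjoint X"
    using psd_mat_factor A by metis
  have "mat_adjoint Y = Y"
    using Y(2) by (simp add: hermitian_mat_def)
  hence "(Y * X) * mat_adjoint (Y * X) = Y * A * Y"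
    using X(1) Y(1) unfolding X(2)
    by (simp add: mat_adjoint_mult[of _ n] assoc_mult_mat[of _ n n _ n _ n])
  thus ?thesis
    using psd_mat_mult_adjoint[of "Y * X" n] X(1) Y(1) by simp
qed

lemma psd_mat_smult:
  assumes "A \<in> carrier_mat n n" "psd_mat A" "r \<ge> 0"
  shows "psd_mat (complex_of_real r \<cdot>\<^sub>m A)"
proof -
  have "hform n (\<lambda>i j. (complex_of_real r \<cdot>\<^sub>m A) $$ (i, j)) x x =
      complex_of_real r * hform n (\<lambda>i j. A $$ (i, j)) x x" for x
    using assms(1) by (simp add: hform_def sum_distrib_left mult_ac)
  thus ?thesis
    using assms by (simp add: psd_mat_iff_hermitian_psd[of _ n] hermitian_psd_def)
qed

lemma psd_mat_add:
  assumes "A \<in> carrier_mat n n" "psd_mat A" "B \<in> carrier_mat n n" "psd_mat B"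
  shows "psd_mat (A + B)"
proof -
  have "hform n (\<lambda>i j. (A + B) $$ (i, j)) x x =
      hform n (\<lambda>i j. A $$ (i, j)) x x + hform n (\<lambda>i j. B $$ (i, j)) x x" for x
    using assms(1,3) by (simp add: hform_def sum.distrib distrib_left distrib_right)
  thus ?thesis
    using assms by (simp add: psd_mat_iff_hermitian_psd[of _ n] hermitian_psd_def)
qed

lemma psd_mat_one: "psd_mat (1\<^sub>m n)"
proof -
  have "mat_adjoint (1\<^sub>m n :: complex mat) = 1\<^sub>m n"
    using hermitian_mat_iff[of "1\<^sub>m n" n] by (simp add: hermitian_mat_def)
  thus ?thesis
    using psd_mat_mult_adjoint[of "1\<^sub>m n" n] by simp
qed

section \<open>Continuity of the coefficients and existence of a minimizer\<close>

lemma continuous_on_coeff_pencil_pow: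
  fixes A B :: "'x :: topological_space \<Rightarrow> complex mat"
  assumes A: "\<And>x. A x \<in> carrier_mat n n" and B: "\<And>x. B x \<in> carrier_mat n n"
    and cA: "\<And>i j. i < n \<Longrightarrow> j < n \<Longrightarrow> continuous_on S (\<lambda>x. A x $$ (i, j))"
    and cB: "\<And>i j. i < n \<Longrightarrow> j < n \<Longrightarrow> continuous_on S (\<lambda>x. B x $$ (i, j))"
    and "i < n" "j < n"
  shows "continuous_on S (\<lambda>x. coeff ((pencil (A x) (B x) ^\<^sub>m N) $$ (i, j)) k)"
  using assms(5,6)
proof (induction N arbitrary: i j k)
  case 0
  thus ?case using B by (auto simp: carrier_matD[OF B])
next
  case (Suc N)
  have "(pencil (A x) (B x) ^\<^sub>m Suc N) $$ (i, j) =
      (\<Sum>l<n. (pencil (A x) (B x) ^\<^sub>m N) $$ (i, l) * [:A x $$ (l, j), B x $$ (l, j):])" for x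
    using Suc.prems
    by (simp add: scalar_prod_def carrier_matD[OF B] pencil_index[OF A B] atLeast0LessThan)
  hence eq: "coeff ((pencil (A x) (B x) ^\<^sub>m Suc N) $$ (i, j)) k =
      (\<Sum>l<n. \<Sum>r\<le>k. coeff ((pencil (A x) (B x) ^\<^sub>m N) $$ (i, l)) r *
        coeff [:A x $$ (l, j), B x $$ (l, j):] (k - r))" for x
    by (simp only: coeff_sum coeff_mult)
  have "continuous_on S (\<lambda>x. coeff [:A x $$ (l, j), B x $$ (l, j):] m)" if "l < n" for l m
  proof -
    consider "m = 0" | "m = 1" | m' where "m = Suc (Suc m')"
      by (metis One_nat_def not0_implies_Suc)
    thus ?thesis
      using that Suc.prems cA[of l j] cB[of l j] by cases auto
  qed
  thus ?case
    unfolding eq using Suc.prems by (intro continuous_on_sum continuous_on_mult Suc.IH) auto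
qed

lemma continuous_on_coeff_bmv_poly:
  fixes A B :: "'x :: topological_space \<Rightarrow> complex mat"
  assumes A: "\<And>x. A x \<in> carrier_mat n n" and B: "\<And>x. B x \<in> carrier_mat n n"
    and cA: "\<And>i j. i < n \<Longrightarrow> j < n \<Longrightarrow> continuous_on S (\<lambda>x. A x $$ (i, j))"
    and cB: "\<And>i j. i < n \<Longrightarrow> j < n \<Longrightarrow> continuous_on S (\<lambda>x. B x $$ (i, j))"
  shows "continuous_on S (\<lambda>x. coeff (bmv_poly N (A x) (B x)) k)"
proof -
  have "coeff (bmv_poly N (A x) (B x)) k = (\<Sum>i<n. coeff ((pencil (A x) (B x) ^\<^sub>m N) $$ (i, i)) k)" for x
    by (simp add: bmv_poly_eq mat_trace_def coeff_sum carrier_matD[OF B])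
  thus ?thesis
    by (simp only:) (intro continuous_on_sum continuous_on_coeff_pencil_pow[OF assms], auto)
qed

text \<open>Since \<open>Tr(X X*)\<close> is the squared Frobenius norm of \<open>X\<close>, the map \<open>X \<mapsto> X X*\<close> sends the compact unit
  sphere onto the positive semidefinite matrices of trace \<open>1\<close>.\<close>
lemma bmv_coeff_minimizer:
  fixes N k :: nat
  assumes A0: "A0 \<in> carrier_mat n n" "psd_mat A0" "mat_trace A0 = 1"
      and B0: "B0 \<in> carrier_mat n n" "psd_mat B0" "mat_trace B0 = 1"
  obtains A B where
    "A \<in> carrier_mat n n" "psd_mat A" "mat_trace A = 1"
    "B \<in> carrier_mat n n" "psd_mat B" "mat_trace B = 1"
    "\<And>A' B'. A' \<in> carrier_mat n n \<Longrightarrow> psd_mat A' \<Longrightarrow> mat_trace A' = 1 \<Longrightarrow>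
             B' \<in> carrier_mat n n \<Longrightarrow> psd_mat B' \<Longrightarrow> mat_trace B' = 1 \<Longrightarrow>
             Re (coeff (bmv_poly N A B) k) \<le> Re (coeff (bmv_poly N A' B') k)"
proof -
  define I where "I = {..<n} \<times> {..<n}"
  define M where "M = (\<lambda>x :: nat \<times> nat \<Rightarrow> complex. mat n n x * mat_adjoint (mat n n x))"
  have M: "M x \<in> carrier_mat n n" "psd_mat (M x)" for x
    unfolding M_def by (simp_all add: psd_mat_mult_adjoint[of _ n])
  have trM: "mat_trace (M x) = complex_of_real (\<Sum>p\<in>I. (cmod (x p))\<^sup>2)" for x
  proof -
    have "(\<Sum>p\<in>I. (cmod (mat n n x $$ p))\<^sup>2) = (\<Sum>p\<in>I. (cmod (x p))\<^sup>2)"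
      by (intro sum.cong) (auto simp: I_def)
    thus ?thesis
      unfolding M_def by (subst mat_trace_mult_adjoint[of _ n]) (auto simp: I_def)
  qed
  have surj: "\<exists>x\<in>l2_sphere I. M x = A" if A: "A \<in> carrier_mat n n" "psd_mat A" "mat_trace A = 1" for A
  proof -
    obtain X where X: "X \<in> carrier_mat n n" "A = X * mat_adjoint X"
      using psd_mat_factor A(1,2) by metis
    \<comment> \<open>The division by \<open>1\<close> matches the shape of \<open>l2_sphere_normalize\<close>.\<close>
    define x where "x = (\<lambda>p. if p \<in> I then X $$ p / complex_of_real 1 else 0)"
    have "(\<Sum>p\<in>I. (cmod (X $$ p))\<^sup>2) = 1"
      using A(3) unfolding X(2) mat_trace_mult_adjoint[OF X(1)] I_def of_real_eq_1_iff .
    hence "x \<in> l2_sphere I"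
      unfolding x_def by (intro l2_sphere_normalize) (auto simp: I_def)
    moreover have "mat n n x = X"
      using X(1) by (intro eq_matI) (auto simp: x_def I_def)
    ultimately show ?thesis
      using X(2) by (auto simp: M_def)
  qed
  have Mentry: "M x $$ (i, j) = (\<Sum>l<n. x (i, l) * cnj (x (j, l)))" if "i < n" "j < n" for x i j
  proof -
    have X: "mat n n x \<in> carrier_mat n n" by simp
    show ?thesis
      unfolding M_def
      using carrier_matD[OF mat_adjoint_carrier[OF X]] that
      by (simp add: scalar_prod_def atLeast0LessThan mat_adjoint_index[OF X])
  qed
  have cont: "continuous_on UNIV (\<lambda>(x, z). Re (coeff (bmv_poly N (M x) (M z)) k))"
  proof -
    have fst: "continuous_on UNIV (\<lambda>w :: (nat \<times> nat \<Rightarrow> complex) \<times> (nat \<times> nat \<Rightarrow> complex). fst w p)" for p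
      by (rule continuous_on_compose2[OF continuous_on_apply[of UNIV]]) (auto intro: continuous_intros)
    have snd: "continuous_on UNIV (\<lambda>w :: (nat \<times> nat \<Rightarrow> complex) \<times> (nat \<times> nat \<Rightarrow> complex). snd w p)" for p
      by (rule continuous_on_compose2[OF continuous_on_apply[of UNIV]]) (auto intro: continuous_intros)
    show ?thesis
      unfolding case_prod_unfold
      by (intro continuous_on_Re continuous_on_coeff_bmv_poly[of _ n] M)
         (simp_all add: Mentry, (intro continuous_intros fst snd)+)
  qed
  have compact: "compact (l2_sphere I \<times> l2_sphere I)"
    by (intro compact_Times compact_l2_sphere)
  have nonempty: "l2_sphere I \<times> l2_sphere I \<noteq> {}"
    using surj[OF A0] by auto
  obtain w where w: "w \<in> l2_sphere I \<times> l2_sphere I"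
    and min: "\<forall>y\<in>l2_sphere I \<times> l2_sphere I. (\<lambda>(x, z). Re (coeff (bmv_poly N (M x) (M z)) k)) w
              \<le> (\<lambda>(x, z). Re (coeff (bmv_poly N (M x) (M z)) k)) y"
    using continuous_attains_inf[OF compact nonempty continuous_on_subset[OF cont subset_UNIV]] by blast
  have tr: "mat_trace (M (fst w)) = 1" "mat_trace (M (snd w)) = 1"
    unfolding trM using w by (auto simp: l2_sphere_def simp del: of_real_sum)
  show ?thesis
  proof (rule that[of "M (fst w)" "M (snd w)"])
    fix A' B'
    assume "A' \<in> carrier_mat n n" "psd_mat A'" "mat_trace A' = 1"
           "B' \<in> carrier_mat n n" "psd_mat B'" "mat_trace B' = 1"
    then obtain x z where "x \<in> l2_sphere I" "z \<in> l2_sphere I" "A' = M x" "B' = M z"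
      using surj by metis
    thus "Re (coeff (bmv_poly N (M (fst w)) (M (snd w))) k) \<le> Re (coeff (bmv_poly N A' B') k)"
      using min by (auto simp: case_prod_unfold)
  qed (use M tr in auto)
qed

section \<open>Descent from exponent \<open>m + 1\<close> to \<open>m\<close>\<close>

text \<open>Splitting \<open>Q = a + s R\<close> leaves \<open>R(0)\<close> as the derivative at \<open>0\<close>.\<close>
lemma DERIV_coeff_poly_const:
  "((\<lambda>s :: real. Re (coeff (poly Q [:complex_of_real s:]) k)) has_real_derivative Re (coeff (coeff Q 1) k)) (at 0)"
proof -
  have diff: "(\<lambda>s :: real. Re (coeff (poly R [:complex_of_real s:]) k)) differentiable at 0" for R :: "complex poly poly"
  proof (induction R)
    case (pCons a R)
    obtain D where "((\<lambda>s. Re (coeff (poly R [:complex_of_real s:]) k)) has_real_derivative D) (at 0)"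
      using pCons.IH real_differentiable_def by blast
    from DERIV_add[OF DERIV_const DERIV_mult[OF DERIV_ident this]]
    show ?case by (auto simp: real_differentiable_def)
  qed simp
  show ?thesis
  proof (cases Q)
    case (pCons a R)
    obtain D where "((\<lambda>s. Re (coeff (poly R [:complex_of_real s:]) k)) has_real_derivative D) (at 0)"
      using diff real_differentiable_def by blast
    from DERIV_add[OF DERIV_const[of "Re (coeff a k)"] DERIV_mult[OF DERIV_ident this]]
    show ?thesis by (simp add: pCons poly_0_coeff_0)
  qed
qed

lemma DERIV_bmv_coeff_congruence:
  assumes "A \<in> carrier_mat n n" "B \<in> carrier_mat n n" "G \<in> carrier_mat n n"
  shows "((\<lambda>s :: real. Re (coeff (bmv_poly (Suc N)
            ((1\<^sub>m n + complex_of_real s \<cdot>\<^sub>m G) * A * (1\<^sub>m n + complex_of_real s \<cdot>\<^sub>m G))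
            ((1\<^sub>m n + complex_of_real s \<cdot>\<^sub>m G) * B * (1\<^sub>m n + complex_of_real s \<cdot>\<^sub>m G))) k))
         has_real_derivative
           2 * real (Suc N) * Re (coeff (mat_trace (pencil A B ^\<^sub>m Suc N * const_mat G)) k)) (at 0)"
proof -
  obtain Q where Q:
    "\<And>s. bmv_poly (Suc N) ((1\<^sub>m n + s \<cdot>\<^sub>m G) * A * (1\<^sub>m n + s \<cdot>\<^sub>m G))
                       ((1\<^sub>m n + s \<cdot>\<^sub>m G) * B * (1\<^sub>m n + s \<cdot>\<^sub>m G)) = poly Q [:s:]"
    "coeff Q 1 = of_nat (2 * Suc N) * mat_trace (pencil A B ^\<^sub>m Suc N * const_mat G)"
    using bmv_poly_congruence_expansion[OF assms, of N] by metis
  have "Re (coeff (coeff Q 1) k) = 2 * real (Suc N) * Re (coeff (mat_trace (pencil A B ^\<^sub>m Suc N * const_mat G)) k)"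
    unfolding Q(2) of_nat_poly by (simp add: algebra_simps del: pow_mat.simps)
  thus ?thesis
    using DERIV_coeff_poly_const[of Q k] unfolding Q(1) by simp
qed

lemma mat_trace_pencil_mult_const:
  fixes A B G :: "complex mat"
  assumes "A \<in> carrier_mat n n" "B \<in> carrier_mat n n" "G \<in> carrier_mat n n"
  shows "mat_trace (pencil A B ^\<^sub>m Suc 0 * const_mat G) = [:mat_trace (A * G), mat_trace (B * G):]"
proof -
  have "pencil (A * G) (B * G) = pencil A B * const_mat G"
    using pencil_mult[of A n B "1\<^sub>m n" G] assms
    by (simp add: semiring_hom.mat_hom_one[OF semiring_hom_const] left_mult_one_mat[of _ n n])
  hence "mat_trace (pencil A B ^\<^sub>m Suc 0 * const_mat G) = bmv_poly (Suc 0) (A * G) (B * G)"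
    using assms by (simp add: bmv_poly_eq carrier_matD[OF assms(2)] carrier_matD[OF assms(3)])
  thus ?thesis
    using assms by (simp add: bmv_poly_1[of _ n])
qed

text \<open>One of the matrices may be zero, so the traces have to be made positive before they are scaled;
  a small multiple of the identity does this without losing the negative sign.\<close>
lemma negative_bmv_coeff_normalized:
  assumes A: "A \<in> carrier_mat n n" "psd_mat A" and B: "B \<in> carrier_mat n n" "psd_mat B"
    and "n > 0" "k \<le> N" and neg: "Re (coeff (bmv_poly N A B) k) < 0"
  obtains A' B' where
    "A' \<in> carrier_mat n n" "psd_mat A'" "mat_trace A' = 1"
    "B' \<in> carrier_mat n n" "psd_mat B'" "mat_trace B' = 1"
    "Re (coeff (bmv_poly N A' B') k) < 0"
proof -
  define pert where "pert = (\<lambda>C (e :: real). C + complex_of_real e \<cdot>\<^sub>m 1\<^sub>m n)"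
  have pert: "pert C e \<in> carrier_mat n n" for C e
    by (simp add: pert_def)
  have pert_psd: "psd_mat (pert C e)" "Re (mat_trace (pert C e)) > 0"
    if C: "C \<in> carrier_mat n n" "psd_mat C" and "e > 0" for C e
  proof -
    show "psd_mat (pert C e)"
      unfolding pert_def using that by (intro psd_mat_add[of _ n] psd_mat_smult[of _ n] psd_mat_one) auto
    have "mat_trace (1\<^sub>m n :: complex mat) = of_nat n"
      by (simp add: mat_trace_def)
    hence "Re (mat_trace (pert C e)) = Re (mat_trace C) + e * real n"
      using C unfolding pert_def by (simp add: mat_trace_add[of _ n] mat_trace_smult[of _ n])
    thus "Re (mat_trace (pert C e)) > 0"
      using mat_trace_psd(2)[OF C] \<open>e > 0\<close> \<open>n > 0\<close> by (simp add: add_nonneg_pos)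
  qed
  define f where "f = (\<lambda>e. Re (coeff (bmv_poly N (pert A e) (pert B e)) k))"
  have "continuous_on UNIV f"
    unfolding f_def
    by (intro continuous_on_Re continuous_on_coeff_bmv_poly[of _ n] pert)
       (auto simp: pert_def intro!: continuous_intros)
  hence "(f \<longlongrightarrow> f 0) (at 0)"
    by (simp add: continuous_on_eq_continuous_at isCont_def)
  moreover have "pert C 0 = C" if "C \<in> carrier_mat n n" for C
    using that by (intro eq_matI) (auto simp: pert_def)
  hence "f 0 < 0"
    using neg A B by (simp add: f_def)
  ultimately have "eventually (\<lambda>e. f e < 0) (at 0)"
    by (rule order_tendstoD(2))
  hence "eventually (\<lambda>e. f e < 0) (at_right 0)"
    by (simp add: eventually_at_split)
  hence "eventually (\<lambda>e. f e < 0 \<and> e > 0) (at_right 0)"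
    by (intro eventually_conj eventually_at_right_less)
  then obtain e where e: "f e < 0" "e > 0"
    using eventually_happens trivial_limit_at_right_real by blast
  define a b where "a = Re (mat_trace (pert A e))" and "b = Re (mat_trace (pert B e))"
  have ab: "a > 0" "b > 0"
    using A B e pert_psd by (auto simp: a_def b_def)
  have tr: "mat_trace (pert A e) = complex_of_real a" "mat_trace (pert B e) = complex_of_real b"
    unfolding a_def b_def using A B e(2) by (intro mat_trace_psd(1)[of _ n] pert pert_psd; simp)+
  show ?thesis
  proof (rule that)
    show "Re (coeff (bmv_poly N (complex_of_real (1 / a) \<cdot>\<^sub>m pert A e) (complex_of_real (1 / b) \<cdot>\<^sub>m pert B e)) k) < 0"
    proof -
      have "Re (coeff (bmv_poly N (complex_of_real (1 / a) \<cdot>\<^sub>m pert A e) (complex_of_real (1 / b) \<cdot>\<^sub>m pert B e)) k) =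
        (1 / a) ^ (N - k) * (1 / b) ^ k * f e"
        unfolding f_def using pert ab \<open>k \<le> N\<close>
        by (subst coeff_bmv_poly_smult[of _ n])
           (simp_all del: of_real_divide add: of_real_power[symmetric] of_real_mult[symmetric] del: of_real_power of_real_mult)
      thus ?thesis
        using ab e by (simp add: mult_pos_neg)
    qed
  qed (use A B ab e in \<open>auto intro!: psd_mat_smult[of _ n] pert pert_psd simp del: of_real_divide\<close>,
       use pert ab in \<open>simp_all add: mat_trace_smult[of _ n] tr\<close>)
qed

text \<open>The variational argument. Taking \<open>G = A + B\<close>, and not \<open>A\<close> or \<open>B\<close> alone, keeps the derivative of
  the lower bound strictly negative for \<open>k = 0\<close> as well as for \<open>k = m\<close>.\<close>
lemma bmv_conjecture_descent:
  assumes bmv: "bmv_conjecture (Suc (Suc N))"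
  shows "bmv_conjecture (Suc N)"
proof (rule ccontr)
  define m where "m = Suc N"
  define T where "T = (\<lambda>k A B. Re (coeff (bmv_poly m A B) k))"
  assume "\<not> bmv_conjecture (Suc N)"
  then obtain n A0 B0 k where "n > 0"
    and A0: "A0 \<in> carrier_mat n n" "psd_mat A0" and B0: "B0 \<in> carrier_mat n n" "psd_mat B0"
    and notin: "coeff (bmv_poly m A0 B0) k \<notin> \<real>\<^sub>\<ge>\<^sub>0"
    by (auto simp: bmv_conjecture_def m_def)
  have neg: "Re (coeff (bmv_poly m A0 B0) k) < 0"
    using notin Im_coeff_bmv_poly_hermitian[of A0 n B0 m k] A0 B0 psd_mat_imp_hermitian
    by (auto simp: complex_nonneg_Reals_iff)
  have "k \<le> m"
  proof (rule ccontr)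
    assume "\<not> k \<le> m"
    hence "coeff (bmv_poly m A0 B0) k = 0"
      using degree_bmv_poly[OF A0(1) B0(1), of m] by (intro coeff_eq_0) auto
    thus False using notin by simp
  qed
  obtain A1 B1 where
    A1: "A1 \<in> carrier_mat n n" "psd_mat A1" "mat_trace A1 = 1" and
    B1: "B1 \<in> carrier_mat n n" "psd_mat B1" "mat_trace B1 = 1" and
    neg1: "T k A1 B1 < 0"
    using negative_bmv_coeff_normalized[OF A0 B0 \<open>n > 0\<close> \<open>k \<le> m\<close> neg] unfolding T_def by metis
  obtain A B where
    A: "A \<in> carrier_mat n n" "psd_mat A" "mat_trace A = 1" and
    B: "B \<in> carrier_mat n n" "psd_mat B" "mat_trace B = 1" and
    min: "\<And>A' B'. A' \<in> carrier_mat n n \<Longrightarrow> psd_mat A' \<Longrightarrow> mat_trace A' = 1 \<Longrightarrow>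
             B' \<in> carrier_mat n n \<Longrightarrow> psd_mat B' \<Longrightarrow> mat_trace B' = 1 \<Longrightarrow> T k A B \<le> T k A' B'"
    unfolding T_def using bmv_coeff_minimizer[OF A1 B1, of m k] by blast
  define \<mu> where "\<mu> = T k A B"
  have "\<mu> < 0"
    using min[OF A1 B1] neg1 by (simp add: \<mu>_def)
  \<comment> \<open>The minimum property, rescaled to arbitrary positive traces.\<close>
  have lower: "\<mu> * Re (mat_trace A') ^ (m - k) * Re (mat_trace B') ^ k \<le> T k A' B'"
    if A': "A' \<in> carrier_mat n n" "psd_mat A'" "Re (mat_trace A') > 0"
      and B': "B' \<in> carrier_mat n n" "psd_mat B'" "Re (mat_trace B') > 0" for A' B'
  proof -
    define a b where "a = Re (mat_trace A')" and "b = Re (mat_trace B')"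
    have ab: "a > 0" "b > 0" using A'(3) B'(3) by (simp_all add: a_def b_def)
    have tr: "mat_trace A' = complex_of_real a" "mat_trace B' = complex_of_real b"
      unfolding a_def b_def using mat_trace_psd(1) A' B' by blast+
    have "\<mu> \<le> T k (complex_of_real (1 / a) \<cdot>\<^sub>m A') (complex_of_real (1 / b) \<cdot>\<^sub>m B')"
      unfolding \<mu>_def
      by (rule min; (rule smult_carrier_mat psd_mat_smult[of _ n])?)
         (use A' B' ab in \<open>simp_all add: mat_trace_smult[of _ n] tr\<close>)
    also have "\<dots> = T k A' B' / (a ^ (m - k) * b ^ k)"
    proof -
      have "coeff (bmv_poly m (complex_of_real (1 / a) \<cdot>\<^sub>m A') (complex_of_real (1 / b) \<cdot>\<^sub>m B')) k =
          complex_of_real ((1 / a) ^ (m - k) * (1 / b) ^ k) * coeff (bmv_poly m A' B') k"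
        using A' B' ab \<open>k \<le> m\<close> by (subst coeff_bmv_poly_smult[of _ n]) simp_all
      thus ?thesis
        by (simp add: T_def power_one_over del: of_real_mult of_real_power of_real_divide)
    qed
    finally show ?thesis
      using ab by (simp add: a_def[symmetric] b_def[symmetric] pos_le_divide_eq mult.assoc)
  qed
  define G where "G = A + B"
  define Y where "Y = (\<lambda>s :: real. 1\<^sub>m n + complex_of_real s \<cdot>\<^sub>m G)"
  define As where "As = (\<lambda>s. Y s * A * Y s)"
  define Bs where "Bs = (\<lambda>s. Y s * B * Y s)"
  have G: "G \<in> carrier_mat n n" using A B by (simp add: G_def)
  have Y: "Y s \<in> carrier_mat n n" "hermitian_mat (Y s)" for s
  proof -
    show Ys: "Y s \<in> carrier_mat n n" using G by (simp add: Y_def)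
    have "hermitian_mat G"
      unfolding G_def by (intro psd_mat_imp_hermitian psd_mat_add[of _ n] A B)
    hence "cnj (G $$ (i, j)) = G $$ (j, i)" if "i < n" "j < n" for i j
      using that G hermitian_mat_iff by metis
    hence "Y s $$ (i, j) = cnj (Y s $$ (j, i))" if "i < n" "j < n" for i j
      using that by (simp add: Y_def carrier_matD[OF G])
    thus "hermitian_mat (Y s)"
      unfolding hermitian_mat_iff[OF Ys] by blast
  qed
  have As: "As s \<in> carrier_mat n n" "psd_mat (As s)" and Bs: "Bs s \<in> carrier_mat n n" "psd_mat (Bs s)" for s
    using Y[of s] A B psd_mat_congruence[of _ n "Y s"] unfolding As_def Bs_def by simp_all
  have "Y 0 = 1\<^sub>m n"
    using G by (intro eq_matI) (auto simp: Y_def)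
  hence AB0: "As 0 = A" "Bs 0 = B"
    using A B by (simp_all add: As_def Bs_def left_mult_one_mat[of _ n n] right_mult_one_mat[of _ n n])
  have fold: "1\<^sub>m n + complex_of_real s \<cdot>\<^sub>m G = Y s" "Y s * A * Y s = As s" "Y s * B * Y s = Bs s" for s
    by (simp_all add: Y_def As_def Bs_def)
  define F where "F = (\<lambda>s. T k (As s) (Bs s))"
  define \<alpha> where "\<alpha> = (\<lambda>s. Re (mat_trace (As s)))"
  define \<beta> where "\<beta> = (\<lambda>s. Re (mat_trace (Bs s)))"
  define F' where "F' = 2 * real m * Re (coeff (mat_trace (pencil A B ^\<^sub>m m * const_mat G)) k)"
  define \<alpha>' where "\<alpha>' = 2 * Re (mat_trace (A * G))"
  define \<beta>' where "\<beta>' = 2 * Re (mat_trace (B * G))"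
  have DF: "(F has_real_derivative F') (at 0)"
    using DERIV_bmv_coeff_congruence[OF A(1) B(1) G, of N k]
    unfolding fold by (simp add: F_def F'_def T_def m_def del: pow_mat.simps)
  \<comment> \<open>The traces are themselves the coefficients for exponent \<open>1\<close>, so the same rule applies.\<close>
  have D\<alpha>: "(\<alpha> has_real_derivative \<alpha>') (at 0)"
    using DERIV_bmv_coeff_congruence[OF A(1) B(1) G, of 0 0]
    unfolding mat_trace_pencil_mult_const[OF A(1) B(1) G] fold bmv_poly_1[OF As(1) Bs(1)]
    by (simp add: \<alpha>_def \<alpha>'_def)
  have D\<beta>: "(\<beta> has_real_derivative \<beta>') (at 0)"
    using DERIV_bmv_coeff_congruence[OF A(1) B(1) G, of 0 1]
    unfolding mat_trace_pencil_mult_const[OF A(1) B(1) G] fold bmv_poly_1[OF As(1) Bs(1)]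
    by (simp add: \<beta>_def \<beta>'_def)
  have "0 \<le> F'"
  proof -
    define P where "P = bmv_poly (Suc m) A B"
    have P: "Re (coeff P j) \<ge> 0" for j
      using bmv A B \<open>n > 0\<close> unfolding bmv_conjecture_def P_def m_def complex_nonneg_Reals_iff by blast
    have "real (Suc m) * Re (coeff (mat_trace (pencil A B ^\<^sub>m m * const_mat G)) k) =
        (real (Suc m) - real k) * Re (coeff P k) + real (Suc k) * Re (coeff P (Suc k))"
      using arg_cong[OF coeff_trace_pencil_pow_mult_sum[OF A(1) B(1), of m k], of Re]
      by (simp add: P_def G_def del: of_nat_Suc)
    also have "\<dots> \<ge> 0"
      using P \<open>k \<le> m\<close> by (intro add_nonneg_nonneg mult_nonneg_nonneg) auto
    finally show ?thesis
      by (simp add: F'_def zero_le_mult_iff)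
  qed
  have "0 < \<alpha>'" "0 < \<beta>'"
  proof -
    have "0 < Re (mat_trace (A * A))" "0 < Re (mat_trace (B * B))"
      using mat_trace_square_pos A B psd_mat_imp_hermitian by (metis zero_neq_one)+
    moreover have "0 \<le> Re (mat_trace (A * B))" "0 \<le> Re (mat_trace (B * A))"
      using mat_trace_mult_psd_nonneg A B by blast+
    moreover have "mat_trace (A * G) = mat_trace (A * A) + mat_trace (A * B)"
        "mat_trace (B * G) = mat_trace (B * A) + mat_trace (B * B)"
      using A B by (simp_all add: G_def mult_add_distrib_mat[of _ n n _ n] mat_trace_add[of _ n])
    ultimately show "0 < \<alpha>'" "0 < \<beta>'"
      by (simp_all add: \<alpha>'_def \<beta>'_def)
  qed
  have \<alpha>\<beta>0: "\<alpha> 0 = 1" "\<beta> 0 = 1" "F 0 = \<mu>"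
    using A B by (simp_all add: \<alpha>_def \<beta>_def F_def AB0 \<mu>_def)
  define H where "H = (\<lambda>s. F s - \<mu> * (\<alpha> s ^ (m - k) * \<beta> s ^ k))"
  define H' where "H' = F' - \<mu> * (real (m - k) * \<alpha>' + real k * \<beta>')"
  have DH: "(H has_real_derivative H') (at 0)"
    unfolding H_def H'_def
    by (rule derivative_eq_intros DF D\<alpha> D\<beta> refl | simp add: \<alpha>\<beta>0)+
  have "0 < real (m - k) * \<alpha>' + real k * \<beta>'"
  proof (cases "k = m")
    case True
    thus ?thesis using \<open>0 < \<beta>'\<close> by (simp add: m_def)
  next
    case False
    thus ?thesis using \<open>0 < \<alpha>'\<close> \<open>0 < \<beta>'\<close> \<open>k \<le> m\<close> by (intro add_pos_nonneg) auto
  qed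
  hence "\<mu> * (real (m - k) * \<alpha>' + real k * \<beta>') < 0"
    using \<open>\<mu> < 0\<close> by (rule mult_neg_pos[rotated])
  hence "H' > 0"
    using \<open>0 \<le> F'\<close> by (simp add: H'_def)
  have "eventually (\<lambda>s. \<alpha> s > 0 \<and> \<beta> s > 0) (at 0)"
  proof (intro eventually_conj)
    show "eventually (\<lambda>s. \<alpha> s > 0) (at 0)"
      using DERIV_isCont[OF D\<alpha>] \<alpha>\<beta>0 by (intro order_tendstoD(1)[of _ 1]) (auto simp: isCont_def)
    show "eventually (\<lambda>s. \<beta> s > 0) (at 0)"
      using DERIV_isCont[OF D\<beta>] \<alpha>\<beta>0 by (intro order_tendstoD(1)[of _ 1]) (auto simp: isCont_def)
  qed
  then obtain d where d: "d > 0" "\<And>s. s \<noteq> 0 \<Longrightarrow> \<bar>s\<bar> < d \<Longrightarrow> \<alpha> s > 0 \<and> \<beta> s > 0"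
    by (auto simp: eventually_at dist_real_def)
  have "H 0 \<le> H s" if "\<bar>0 - s\<bar> < d" for s
  proof (cases "s = 0")
    case False
    hence "\<alpha> s > 0" "\<beta> s > 0" using d(2) that by auto
    hence "H s \<ge> 0"
      using lower[OF As(1,2) _ Bs(1,2), of s s]
      by (simp add: H_def F_def \<alpha>_def \<beta>_def mult.assoc)
    thus ?thesis by (simp add: H_def \<alpha>\<beta>0)
  qed simp
  hence "H' = 0"
    using DERIV_local_min[OF DH d(1)] by blast
  thus False using \<open>H' > 0\<close> by simp
qed

theorem corollary1p9:
  assumes "infinite {m :: nat. m > 0 \<and> bmv_conjecture m}"
  shows "\<forall>m :: nat. m > 0 \<longrightarrow> bmv_conjecture m"
proof (intro allI impI)
  fix m :: nat assume "m > 0"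
  obtain M where "M \<ge> m" "bmv_conjecture M"
    using assms by (auto simp: infinite_nat_iff_unbounded_le)
  from this(1,2) show "bmv_conjecture m"
  proof (induction rule: dec_induct)
    case (step j)
    show ?case
    proof (rule step.IH)
      show "bmv_conjecture j"
        using bmv_conjecture_descent[of "j - 1"] step \<open>m > 0\<close> by simp
    qed
  qed
qed

end
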